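(* Let $F$ be a fullerene with $n\equiv 4\pmod 6$ vertices and $c(F)=\lfloor n/6\rfloor-2$, and let $(\mathcal{H},M)$ be a Clar structure of $F$. Then $\mathcal{L}^{-1}(\mathscr{E}(\mathcal{H},M))$ is a plane graph with $(n+14)/3$ vertices such that (i) its faces are exactly $8$ quadrilaterals and otherwise hexagons; (ii) it has exactly two vertices of degree $4$ and all other vertices have degree $3$; (iii) each vertex of degree $4$ is incident with at least $2$ quadrilaterals; (iv) each of the two partite sets of its bipartition contains exactly one vertex of degree $4$.
   Context: A fullerene is a finite, trivalent plane graph all of whose faces are pentagons and hexagons. For a perfect matching, a face is alternating if exactly half of its boundary edges lie in it. A resonant pattern is a set of pairwise vertex-disjoint faces all alternating with respect to one common perfect matching; $c(F)$ is the maximum size of a resonant pattern, and a Clar set is one of size $c(F)$. A Clar structure is a pair $(\mathcal{H},M)$ with $\mathcal{H}$ a Clar set and $M$ a perfect matching of $F$ minus the vertices of the faces in $\mathcal{H}$. The expansion $\mathscr{E}(\mathcal{H},M)$ is obtained from $F$ by widening each edge $uv\in M$ into a quadrilateral face (each of $u,v$ is split into an edge, with two new edges joining the split pairs, the other edges at $u,v$ distributed consistently with the embedding); let $\mathcal{Q}$ be the set of these new quadrilaterals. The parent $\mathcal{L}^{-1}(\mathscr{E}(\mathcal{H},M))$ is the plane graph with one vertex inside each face of $\mathscr{E}(\mathcal{H},M)$ not in $\mathcal{H}\cup\mathcal{Q}$, two vertices joined when the corresponding faces share an edge. It is a connected plane graph all of whose faces have even length, hence bipartite with a unique bipartition. 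*)

theory Defs
  imports Complex_Main "HOL-Combinatorics.Orbits" "Graph_Theory.Graph_Theory"
begin

text \<open>
  A graph embedded in the sphere is given combinatorially: every edge is a pair of opposite arcs
  exchanged by \<open>edge_rev\<close>, and \<open>edge_succ\<close> maps an arc to the next arc, in counterclockwise order,
  with the same tail (rotation system). Connected plane graphs correspond, up to
  homeomorphism of the sphere, to connected rotation systems of Euler characteristic 2.
\<close>

record ('v, 'd) embedded_graph =
  graph_of :: "('v, 'd) pre_digraph"
  edge_rev :: "'d \<Rightarrow> 'd"
  edge_succ :: "'d \<Rightarrow> 'd"

abbreviation vertices :: "('v, 'd) embedded_graph \<Rightarrow> 'v set" where
  "vertices G \<equiv> verts (graph_of G)"

abbreviation darts :: "('v, 'd) embedded_graph \<Rightarrow> 'd set" where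
  "darts G \<equiv> arcs (graph_of G)"

abbreviation degree :: "('v, 'd) embedded_graph \<Rightarrow> 'v \<Rightarrow> nat" where
  "degree G v \<equiv> out_degree (graph_of G) v"

definition edge_of :: "('v, 'd) embedded_graph \<Rightarrow> 'd \<Rightarrow> 'd set" where
  "edge_of G a = {a, edge_rev G a}"

definition edges :: "('v, 'd) embedded_graph \<Rightarrow> 'd set set" where
  "edges G = edge_of G ` darts G"

definition ends :: "('v, 'd) embedded_graph \<Rightarrow> 'd set \<Rightarrow> 'v set" where
  "ends G e = tail (graph_of G) ` e"

text \<open>
  A face is identified with the set of arcs that have it on their right-hand side; \<open>face_succ\<close>
  walks around it.
\<close>

definition face_succ :: "('v, 'd) embedded_graph \<Rightarrow> 'd \<Rightarrow> 'd" where
  "face_succ G a = edge_succ G (edge_rev G a)"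

definition face_of :: "('v, 'd) embedded_graph \<Rightarrow> 'd \<Rightarrow> 'd set" where
  "face_of G a = orbit (face_succ G) a"

definition faces :: "('v, 'd) embedded_graph \<Rightarrow> 'd set set" where
  "faces G = face_of G ` darts G"

definition face_verts :: "('v, 'd) embedded_graph \<Rightarrow> 'd set \<Rightarrow> 'v set" where
  "face_verts G f = tail (graph_of G) ` f"

definition face_edges :: "('v, 'd) embedded_graph \<Rightarrow> 'd set \<Rightarrow> 'd set set" where
  "face_edges G f = edge_of G ` f"

text \<open>The boundary walk of the face has length \<open>k\<close> and is a cycle (no repeated vertex).\<close>

definition is_gon :: "nat \<Rightarrow> ('v, 'd) embedded_graph \<Rightarrow> 'd set \<Rightarrow> bool" where
  "is_gon k G f \<longleftrightarrow> card f = k \<and> inj_on (tail (graph_of G)) f"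

text \<open>
  Connected finite simple plane graphs. Faces being sets of arcs, the one-vertex graph is excluded
  by the Euler formula.
\<close>

definition plane_graph :: "('v, 'd) embedded_graph \<Rightarrow> bool" where
  "plane_graph G \<longleftrightarrow>
     Digraph.graph (graph_of G) \<and>
     bidirected_digraph (graph_of G) (edge_rev G) \<and>
     edge_succ G permutes darts G \<and>
     (\<forall>v \<in> vertices G. out_arcs (graph_of G) v \<noteq> {} \<longrightarrow>
        cyclic_on (edge_succ G) (out_arcs (graph_of G) v)) \<and>
     Digraph_Component.connected (graph_of G) \<and>
     int (card (vertices G)) - int (card (edges G)) + int (card (faces G)) = 2"

definition fullerene :: "('v, 'd) embedded_graph \<Rightarrow> bool" where
  "fullerene F \<longleftrightarrow>
     plane_graph F \<and>
     (\<forall>v \<in> vertices F. degree F v = 3) \<and>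
     (\<forall>f \<in> faces F. is_gon 5 F f \<or> is_gon 6 F f)"

text \<open>Perfect matchings of the subgraph of \<open>G\<close> induced by the vertex set \<open>U\<close>.\<close>

definition perfect_matching_on :: "('v, 'd) embedded_graph \<Rightarrow> 'v set \<Rightarrow> 'd set set \<Rightarrow> bool" where
  "perfect_matching_on G U M \<longleftrightarrow>
     M \<subseteq> edges G \<and>
     (\<forall>e \<in> M. ends G e \<subseteq> U) \<and>
     (\<forall>v \<in> U. \<exists>!e. e \<in> M \<and> v \<in> ends G e)"

abbreviation perfect_matching :: "('v, 'd) embedded_graph \<Rightarrow> 'd set set \<Rightarrow> bool" where
  "perfect_matching G M \<equiv> perfect_matching_on G (vertices G) M"

definition alternating :: "('v, 'd) embedded_graph \<Rightarrow> 'd set set \<Rightarrow> 'd set \<Rightarrow> bool" where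
  "alternating G M f \<longleftrightarrow> 2 * card (face_edges G f \<inter> M) = card (face_edges G f)"

definition resonant_pattern :: "('v, 'd) embedded_graph \<Rightarrow> 'd set set \<Rightarrow> bool" where
  "resonant_pattern G H \<longleftrightarrow>
     H \<subseteq> faces G \<and>
     pairwise (\<lambda>f g. disjnt (face_verts G f) (face_verts G g)) H \<and>
     (\<exists>M. perfect_matching G M \<and> (\<forall>f \<in> H. alternating G M f))"

definition clar_number :: "('v, 'd) embedded_graph \<Rightarrow> nat" where
  "clar_number G = Max (card ` {H. resonant_pattern G H})"

definition clar_set :: "('v, 'd) embedded_graph \<Rightarrow> 'd set set \<Rightarrow> bool" where
  "clar_set G H \<longleftrightarrow> resonant_pattern G H \<and> card H = clar_number G"

definition clar_structure :: "('v, 'd) embedded_graph \<Rightarrow> 'd set set \<Rightarrow> 'd set set \<Rightarrow> bool" where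
  "clar_structure G H M \<longleftrightarrow>
     clar_set G H \<and>
     perfect_matching_on G (vertices G - (\<Union>f \<in> H. face_verts G f)) M"

text \<open>
  The expansion of a cubic plane graph \<open>G\<close> along a matching \<open>M\<close>. Let \<open>a\<close> be an arc from \<open>u\<close> to \<open>v\<close>
  whose edge is in \<open>M\<close>. Looking from \<open>u\<close> towards \<open>v\<close>, the vertex \<open>u\<close> is split into a left and a
  right copy; \<open>SideL a\<close> and \<open>SideR a\<close> are the left and right copies of \<open>a\<close>, leaving these two
  vertices, and \<open>EndL a\<close>, \<open>EndR a\<close> are the two arcs of the new edge between them, leaving the left
  and the right copy, respectively. The left copy of \<open>u\<close> keeps the edge at \<open>u\<close> following \<open>a\<close> in
  counterclockwise order, the right copy keeps the edge preceding \<open>a\<close>. Counterclockwise around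
  the left copy one therefore meets \<open>SideL a\<close>, \<open>Keep (edge_succ G a)\<close>, \<open>EndL a\<close>, and
  around the right copy \<open>SideR a\<close>, \<open>EndR a\<close>, \<open>Keep (edge_succ G (edge_succ G a))\<close>.
\<close>

datatype 'd exp_dart = Keep 'd | SideL 'd | SideR 'd | EndL 'd | EndR 'd

definition exp_darts :: "('v, 'd) embedded_graph \<Rightarrow> 'd set set \<Rightarrow> 'd exp_dart set" where
  "exp_darts G M =
     Keep ` {a \<in> darts G. edge_of G a \<notin> M} \<union>
     (\<Union>a \<in> {a \<in> darts G. edge_of G a \<in> M}. {SideL a, SideR a, EndL a, EndR a})"

primrec exp_rev :: "('v, 'd) embedded_graph \<Rightarrow> 'd exp_dart \<Rightarrow> 'd exp_dart" where
  "exp_rev G (Keep a) = Keep (edge_rev G a)"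
| "exp_rev G (SideL a) = SideR (edge_rev G a)"
| "exp_rev G (SideR a) = SideL (edge_rev G a)"
| "exp_rev G (EndL a) = EndR a"
| "exp_rev G (EndR a) = EndL a"

primrec exp_succ :: "('v, 'd) embedded_graph \<Rightarrow> 'd set set \<Rightarrow> 'd exp_dart \<Rightarrow> 'd exp_dart" where
  "exp_succ G M (Keep a) =
     (let b = edge_succ G a; c = edge_succ G b in
      if edge_of G b \<in> M then SideR b
      else if edge_of G c \<in> M then EndL c
      else Keep b)"
| "exp_succ G M (SideL a) = Keep (edge_succ G a)"
| "exp_succ G M (SideR a) = EndR a"
| "exp_succ G M (EndL a) = SideL a"
| "exp_succ G M (EndR a) = Keep (edge_succ G (edge_succ G a))"

text \<open>Vertices of the expansion are represented by their sets of outgoing arcs.\<close>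

definition expansion ::
  "('v, 'd) embedded_graph \<Rightarrow> 'd set set \<Rightarrow> ('d exp_dart set, 'd exp_dart) embedded_graph" where
  "expansion G M =
     (let D = exp_darts G M;
          vertex_of = orbit (exp_succ G M)
      in \<lparr> graph_of = \<lparr> verts = vertex_of ` D, arcs = D,
                       tail = vertex_of, head = (\<lambda>x. vertex_of (exp_rev G x)) \<rparr>,
           edge_rev = perm_restrict (exp_rev G) D,
           edge_succ = perm_restrict (exp_succ G M) D \<rparr>)"

definition new_quads :: "('v, 'd) embedded_graph \<Rightarrow> 'd set set \<Rightarrow> 'd exp_dart set set" where
  "new_quads G M =
     (\<lambda>a. {SideL a, EndR (edge_rev G a), SideL (edge_rev G a), EndR a})
       ` {a \<in> darts G. edge_of G a \<in> M}"

text \<open>The faces in \<open>H\<close> avoid the edges of \<open>M\<close> and persist in the expansion.\<close>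

definition kept_faces :: "'d set set \<Rightarrow> 'd exp_dart set set" where
  "kept_faces H = (\<lambda>f. Keep ` f) ` H"

definition first_return :: "('a \<Rightarrow> 'a) \<Rightarrow> 'a set \<Rightarrow> 'a \<Rightarrow> 'a" where
  "first_return f S a = (f ^^ (LEAST k. 0 < k \<and> (f ^^ k) a \<in> S)) a"

text \<open>
  The inverse leapfrog transform with respect to a set \<open>X\<close> of faces: one vertex in each face not in
  \<open>X\<close>, and one edge for each edge of \<open>G\<close> shared by two such faces. The arc that crosses \<open>a\<close> from the
  face of \<open>a\<close> to the face of \<open>edge_rev G a\<close> is again called \<open>a\<close>, and the arcs around a vertex come in
  the order in which they occur along the boundary of the corresponding face. As \<open>face_succ\<close> has its
  face on the right, this is the clockwise order, i.e. the result is drawn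
  on the sphere with the opposite orientation.
\<close>

definition inverse_leapfrog ::
  "('v, 'd) embedded_graph \<Rightarrow> 'd set set \<Rightarrow> ('d set, 'd) embedded_graph" where
  "inverse_leapfrog G X =
     (let V = faces G - X;
          D = {a \<in> darts G. face_of G a \<in> V \<and> face_of G (edge_rev G a) \<in> V}
      in \<lparr> graph_of = \<lparr> verts = V, arcs = D,
                       tail = face_of G, head = (\<lambda>a. face_of G (edge_rev G a)) \<rparr>,
           edge_rev = perm_restrict (edge_rev G) D,
           edge_succ = perm_restrict (first_return (face_succ G) D) D \<rparr>)"

definition parent ::
  "('v, 'd) embedded_graph \<Rightarrow> 'd set set \<Rightarrow> 'd set set \<Rightarrow>
   ('d exp_dart set, 'd exp_dart) embedded_graph" where
  "parent F H M = inverse_leapfrog (expansion F M) (kept_faces H \<union> new_quads F M)"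

definition bipartition :: "('v, 'd) embedded_graph \<Rightarrow> 'v set \<Rightarrow> 'v set \<Rightarrow> bool" where
  "bipartition G A B \<longleftrightarrow>
     A \<union> B = vertices G \<and> A \<inter> B = {} \<and>
     (\<forall>a \<in> darts G. tail (graph_of G) a \<in> A \<longleftrightarrow> head (graph_of G) a \<in> B)"

end

theory Submission
  imports Defs
begin

text \<open>
  An even set of edges in the sphere (one meeting every face evenly) is an edge cut: the edge sets
  that are even number at most \<open>2 ^ (|V| - 1)\<close> by Euler's formula, and there are that many cuts.
  Applied to a fullerene, two faces sharing two edges give a cut of size two; on one of its sides
  the two faces have together at most six vertices, counted with multiplicity. Peeling vertices off
  that side yields ever smaller cuts of the same kind, which is impossible. Hence the dual of a fullerene is simple.

  The parent is the dual of the fullerene with the vertices in \<open>H\<close> and the edges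
  crossing \<open>M\<close> deleted. Its faces are the hexagons of \<open>H\<close> and one quadrilateral for each edge in \<open>M\<close>,
  and the equation \<open>n = 6 * card H + 16\<close> gives all the numbers; the degrees, all at least three, exceed
  three by two in total. All faces being even, the set of all edges is a cut, so
  the parent is bipartite, and counting edges modulo 3 shows that the excess is 1 in both classes.
  At a vertex of degree 4, at least two pairs of consecutive edges cross consecutive edges of
  the fullerene face, and each such pair bounds a quadrilateral.
\<close>

section \<open>Plane graphs\<close>

text \<open>A rotation system offers no curves and no insides; besides connectedness, Euler's
  formula is its only global datum, so separation has to come from counting.
  \<open>odd_faces\<close> is the boundary map of the dual over the two-element field, and its rank
  leaves no room for an even set that is not a cut.

  The obstacle is that two faces might a priori meet in several edges. Then the parent could have
  parallel edges, and its faces need not be cycles: the faces at the two ends of a matched edge, or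
  two neighbours of a hexagon of \<open>H\<close>, could coincide. The descent that excludes this
  works because 6 is half of the at most 12 boundary vertices of the two faces and also bounds every
  single face length.

  Each vertex of the fullerene is the tail of exactly one dart that is matched or lies on a face of
  \<open>H\<close>. Hence deleted edges are never consecutive on a surviving face, which makes all
  parent degrees at least three, and the matching covers n - 6 * card H vertices. For n = 6m + 4 and
  card H = m - 2 these are 16, so \<open>M\<close> has 8 edges, one for each quadrilateral.\<close>

lemma card_edges_bidirected:
  fixes G :: "('v, 'd) embedded_graph"
  assumes "fin_digraph (graph_of G)" "bidirected_digraph (graph_of G) (edge_rev G)"
  shows "2 * card (edges G) = card (darts G)"
proof -
  interpret fin_digraph "graph_of G" by fact
  interpret bi: bidirected_digraph "graph_of G" "edge_rev G" by fact
  have U: "\<Union> (edges G) = darts G"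
    by (auto simp: edges_def edge_of_def)
  have "2 * card (edges G) = card (\<Union> (edges G))"
  proof (rule card_partition)
    show "finite (edges G)" by (simp add: edges_def)
    show "finite (\<Union> (edges G))" unfolding U by simp
    show "card c = 2" if c: "c \<in> edges G" for c
    proof -
      obtain a where "a \<in> darts G" "c = {a, edge_rev G a}" using c by (auto simp: edges_def edge_of_def)
      then show ?thesis using bi.arev_neq[of a] by simp
    qed
    show "c1 \<inter> c2 = {}" if c: "c1 \<in> edges G" "c2 \<in> edges G" "c1 \<noteq> c2" for c1 c2
    proof -
      obtain a b where "c1 = {a, edge_rev G a}" "c2 = {b, edge_rev G b}"
        using c by (auto simp: edges_def edge_of_def)
      then show ?thesis using c(3) by (auto simp: bi.arev_eq_iff)
    qed
  qed
  then show ?thesis using U by simp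
qed

locale plane_map =
  fixes G :: "('v, 'd) embedded_graph"
  assumes plane: "plane_graph G"
begin

abbreviation "opp \<equiv> edge_rev G"
abbreviation "rot \<equiv> edge_succ G"
abbreviation "phi \<equiv> face_succ G"
abbreviation "D \<equiv> darts G"
abbreviation "V \<equiv> vertices G"
abbreviation "src \<equiv> tail (graph_of G)"
abbreviation "dst \<equiv> head (graph_of G)"

sublocale gr: Digraph.graph "graph_of G"
  using plane by (simp add: plane_graph_def)

sublocale bi: bidirected_digraph "graph_of G" opp
  using plane by (simp add: plane_graph_def)

lemma rot_permutes: "rot permutes D"
  using plane by (simp add: plane_graph_def)

lemma rot_cyclic: "v \<in> V \<Longrightarrow> out_arcs (graph_of G) v \<noteq> {} \<Longrightarrow> cyclic_on rot (out_arcs (graph_of G) v)"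
  using plane by (simp add: plane_graph_def)

lemma euler: "int (card V) - int (card (edges G)) + int (card (faces G)) = 2"
  using plane by (simp add: plane_graph_def)

lemma connected: "Digraph_Component.connected (graph_of G)"
  using plane by (simp add: plane_graph_def)

lemma opp_in [simp]: "opp a \<in> D \<longleftrightarrow> a \<in> D"
  by (metis bi.arev_arev bi.arev_in_arcs)

lemma opp_opp [simp]: "opp (opp a) = a"
  by simp

lemma src_opp [simp]: "a \<in> D \<Longrightarrow> src (opp a) = dst a"
  by simp

lemma dst_opp [simp]: "a \<in> D \<Longrightarrow> dst (opp a) = src a"
  by simp

lemma rot_in [simp]: "rot a \<in> D \<longleftrightarrow> a \<in> D"
  using rot_permutes by (simp add: permutes_in_image)

lemma rot_inj: "rot a = rot b \<longleftrightarrow> a = b"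
  using rot_permutes by (metis permutes_def)

lemma src_neq_dst: "a \<in> D \<Longrightarrow> src a \<noteq> dst a"
  using gr.no_loops by blast

lemma no_multi: "a \<in> D \<Longrightarrow> b \<in> D \<Longrightarrow> src a = src b \<Longrightarrow> dst a = dst b \<Longrightarrow> a = b"
  using gr.no_multi_arcs by (simp add: arc_to_ends_def)

lemma out_orbit: "a \<in> D \<Longrightarrow> out_arcs (graph_of G) (src a) = orbit rot a"
  using rot_cyclic[of "src a"] orbit_cyclic_eq3[of rot _ a] by (metis empty_iff gr.tail_in_verts in_out_arcs_conv)

lemma src_rot [simp]: "a \<in> D \<Longrightarrow> src (rot a) = src a"
  using out_orbit[of a] orbit.base[of rot a] by auto

lemma same_src_orbit:
  assumes "a \<in> D" "b \<in> D" shows "src b = src a \<longleftrightarrow> b \<in> orbit rot a"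
  using assms unfolding out_orbit[OF assms(1), symmetric] by (simp)

lemma phi_permutes: "phi permutes D"
proof -
  have "rot \<circ> opp permutes D"
    using bi.arev_permutes_arcs rot_permutes by (rule permutes_compose)
  moreover have "rot \<circ> opp = phi"
    by (auto simp: face_succ_def)
  ultimately show ?thesis by simp
qed

lemma phi_in [simp]: "phi a \<in> D \<longleftrightarrow> a \<in> D"
  by (simp add: face_succ_def)

lemma phi_inj: "phi a = phi b \<longleftrightarrow> a = b"
  using phi_permutes by (metis permutes_def)

lemma src_phi [simp]: "a \<in> D \<Longrightarrow> src (phi a) = dst a"
  by (simp add: face_succ_def)

lemma phi_permutation: "permutation phi"
  using phi_permutes gr.finite_arcs by (metis permutation_permutes)

lemma funpow_in [simp]: "(phi ^^ k) a \<in> D \<longleftrightarrow> a \<in> D"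
  by (induction k) auto

lemma self_in_face [simp]: "a \<in> face_of G a"
  by (simp add: face_of_def permutation_self_in_orbit phi_permutation)

lemma face_of_cyclic: "cyclic_on phi (face_of G a)"
  unfolding face_of_def by (rule cyclic_on_orbit'[OF phi_permutation])

lemma face_eq_iff: "b \<in> face_of G a \<longleftrightarrow> face_of G b = face_of G a"
  using orbit_cyclic_eq3[OF face_of_cyclic] self_in_face by (metis face_of_def)

lemma face_phi [simp]: "face_of G (phi a) = face_of G a"
  using face_eq_iff orbit.base by (metis face_of_def)

lemma phi_in_face_iff [simp]: "phi b \<in> face_of G a \<longleftrightarrow> b \<in> face_of G a"
  by (simp add: face_eq_iff)

lemma face_funpow [simp]: "face_of G ((phi ^^ k) a) = face_of G a"
  by (induction k) auto

lemma face_subset: "a \<in> D \<Longrightarrow> face_of G a \<subseteq> D"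
  unfolding face_of_def by (rule permutes_orbit_subset[OF phi_permutes])

lemma face_in_faces: "a \<in> D \<Longrightarrow> face_of G a \<in> faces G"
  by (simp add: faces_def)

lemma facesE: assumes "f \<in> faces G" obtains a where "a \<in> D" "f = face_of G a"
  using assms by (auto simp: faces_def)

lemma face_of_mem: "f \<in> faces G \<Longrightarrow> a \<in> f \<Longrightarrow> face_of G a = f"
  by (auto simp: faces_def face_eq_iff)

lemma mem_face_in: "f \<in> faces G \<Longrightarrow> a \<in> f \<Longrightarrow> a \<in> D"
  using face_subset by (auto simp: faces_def)

lemma finite_face [simp]: "f \<in> faces G \<Longrightarrow> finite f"
  using finite_subset[OF _ gr.finite_arcs] face_subset by (auto simp: faces_def)

lemma finite_faces [simp]: "finite (faces G)"
  by (simp add: faces_def)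

lemma phi_bij_face: "bij_betw phi (face_of G a) (face_of G a)"
proof -
  have "phi ` face_of G a = face_of G a"
  proof
    show "face_of G a \<subseteq> phi ` face_of G a"
    proof
      fix x assume x: "x \<in> face_of G a"
      obtain y where y: "x = phi y"
        using phi_permutes by (metis permutes_surj surjD)
      then show "x \<in> phi ` face_of G a" using x by simp
    qed
  qed auto
  then show ?thesis
    by (simp add: bij_betw_def inj_on_def phi_inj)
qed

lemma funpow_card_face: assumes "a \<in> D" shows "(phi ^^ card (face_of G a)) a = a"
proof -
  have s: "a \<in> orbit phi a" using self_in_face by (simp add: face_of_def)
  have "card (orbit phi a) = funpow_dist1 phi a a"
    unfolding orbit_conv_funpow_dist1[OF s]
    using inj_on_funpow_dist1[OF s] by (simp add: card_image)
  then show ?thesis using funpow_dist1_prop[OF s] by (simp add: face_of_def)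
qed

text \<open>Otherwise \<open>a\<close> would already return after the positive remainder
  \<open>k mod ?n\<close>, and its orbit would have fewer than \<open>?n\<close> elements.\<close>

lemma funpow_return_dvd:
  assumes "a \<in> D" "(phi ^^ k) a = a"
  shows "card (face_of G a) dvd k"
proof (rule ccontr)
  let ?n = "card (face_of G a)"
  assume nd: "\<not> ?n dvd k"
  have n: "?n > 0" using assms(1) self_in_face
    by (metis card_gt_0_iff empty_iff face_in_faces finite_face)
  have "(phi ^^ (k mod ?n)) a = a"
    using funpow_mod_eq[OF funpow_card_face[OF assms(1)], of k] assms(2) by simp
  moreover have "0 < k mod ?n" using nd by (simp add: mod_greater_zero_iff_not_dvd)
  ultimately have "face_of G a = {(phi ^^ m) a |m. m < k mod ?n}"
    unfolding face_of_def by (rule orbit_altdef_bounded)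
  also have "\<dots> = (\<lambda>m. (phi ^^ m) a) ` {..<k mod ?n}" by auto
  finally have "?n \<le> k mod ?n" by (metis card_image_le card_lessThan finite_lessThan)
  then show False using mod_less_divisor[OF n, of k] by linarith
qed

lemma edge_of_opp [simp]: "edge_of G (opp a) = edge_of G a"
  by (auto simp: edge_of_def)

lemma edge_of_eq_iff: "edge_of G a = edge_of G b \<longleftrightarrow> a = b \<or> a = opp b"
  by (auto simp: edge_of_def doubleton_eq_iff)

lemma card_edges: "2 * card (edges G) = card D"
  by (rule card_edges_bidirected) unfold_locales

lemma vertex_connected:
  assumes "W \<subseteq> V" "W \<noteq> {}"
    and closed: "\<And>a. a \<in> D \<Longrightarrow> src a \<in> W \<Longrightarrow> dst a \<in> W"
  shows "W = V"
proof -
  obtain w where w: "w \<in> W" using assms(2) by auto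
  have sc: "strongly_connected (graph_of G)"
    by (rule gr.symmetric_connected_imp_strongly_connected[OF gr.sym_arcs connected])
  have "v \<in> W" if "v \<in> V" for v
  proof -
    have "w \<rightarrow>\<^sup>*\<^bsub>graph_of G\<^esub> v"
      using sc w assms(1) that unfolding strongly_connected_def by (meson subsetD)
    then show ?thesis
    proof (induction rule: gr.reachable_induct)
      case base then show ?case using w by simp
    next
      case (step x y)
      then obtain a where a: "a \<in> D" "src a = x" "dst a = y" by (meson reachableE)
      then show ?case using closed[OF a(1)] step.IH by simp
    qed
  qed
  then show ?thesis using assms(1) by auto
qed

lemma V_nonempty: "V \<noteq> {}"
  using connected by (simp add: connected_conv)

lemma D_nonempty: "D \<noteq> {}"
proof
  assume e: "D = {}"
  obtain v where v: "v \<in> V" using V_nonempty by auto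
  have "{v} = V" by (rule vertex_connected) (use v e in auto)
  from this[symmetric] have "card V = 1" by simp
  then show False using euler e by (simp add: edges_def faces_def)
qed

text \<open>A set closed under \<open>rot\<close> is a union of full vertex stars, so connectedness
  of the vertices carries over. This form suits walks in the dual, which move by \<open>opp\<close>
  across an edge and by \<open>rot\<close> around a vertex.\<close>

lemma dart_connected:
  assumes "T \<subseteq> D" "T \<noteq> {}"
    and r: "\<And>a. a \<in> T \<Longrightarrow> opp a \<in> T" and s: "\<And>a. a \<in> T \<Longrightarrow> rot a \<in> T"
  shows "T = D"
proof -
  have orb: "b \<in> T" if "a \<in> T" "b \<in> orbit rot a" for a b
    using that(2) by (induction) (simp_all add: s that(1))
  have same: "b \<in> T" if "a \<in> T" "b \<in> D" "src b = src a" for a b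
    using that orb[of a b] same_src_orbit[of a b] assms(1) by auto
  have "src ` T = V"
  proof (rule vertex_connected)
    show "dst a \<in> src ` T" if "a \<in> D" "src a \<in> src ` T" for a
    proof -
      have "a \<in> T" using that same[of _ a] by (metis imageE)
      then show ?thesis using r[of a] that by (intro image_eqI[of _ _ "opp a"]) simp_all
    qed
  next
    show "src ` T \<subseteq> V" using assms(1) gr.tail_in_verts by blast
  next
    show "src ` T \<noteq> {}" using assms(2) by simp
  qed
  show ?thesis
  proof
    show "D \<subseteq> T"
    proof
      fix b assume b: "b \<in> D"
      then have "src b \<in> src ` T" unfolding \<open>src ` T = V\<close> by simp
      then obtain a where "a \<in> T" "src a = src b" by (metis imageE)
      then show "b \<in> T" using same[of a b] b by simp
    qed
  qed (rule assms(1))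
qed

end

section \<open>Cuts and even edge sets in the sphere\<close>

lemma odd_card_sym_diff:
  assumes "finite A" "finite B"
  shows "odd (card (sym_diff A B)) \<longleftrightarrow> odd (card A) \<noteq> odd (card B)"
proof -
  have "card A = card (A - B) + card (A \<inter> B)"
    using assms card_Int_Diff[of A B] by simp
  moreover have "card B = card (B - A) + card (A \<inter> B)"
    using assms card_Int_Diff[of B A] by (simp add: Int_commute)
  moreover have "card (sym_diff A B) = card (A - B) + card (B - A)"
    using assms by (intro card_Un_disjoint) auto
  ultimately show ?thesis by simp presburger
qed

lemma sym_diff_cancel: "sym_diff A B = sym_diff A C \<Longrightarrow> B = C"
  by blast

context plane_map
begin

text \<open>The boundary modulo 2 of \<open>S\<close>, read as a set of dual edges. Darts are
  counted, so an edge with the same face on both sides would count twice and cancel.\<close>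

definition odd_faces :: "'d set set \<Rightarrow> 'd set set" where
  "odd_faces S = {f \<in> faces G. odd (card {a \<in> f. edge_of G a \<in> S})}"

definition edge_cut :: "'v set \<Rightarrow> 'd set set" where
  "edge_cut U = edge_of G ` {a \<in> D. (src a \<in> U) \<noteq> (dst a \<in> U)}"

lemma finite_edges [simp]: "finite (edges G)"
  by (simp add: edges_def)

lemma odd_faces_sym_diff: "odd_faces (sym_diff S T) = sym_diff (odd_faces S) (odd_faces T)"
proof -
  have "odd (card {a \<in> f. edge_of G a \<in> sym_diff S T}) \<longleftrightarrow>
      odd (card {a \<in> f. edge_of G a \<in> S}) \<noteq> odd (card {a \<in> f. edge_of G a \<in> T})" if "f \<in> faces G" for f
  proof -
    have "{a \<in> f. edge_of G a \<in> sym_diff S T} =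
        sym_diff {a \<in> f. edge_of G a \<in> S} {a \<in> f. edge_of G a \<in> T}" by blast
    then show ?thesis using that by (simp only:, intro odd_card_sym_diff) auto
  qed
  then show ?thesis unfolding odd_faces_def by blast
qed

lemma odd_faces_edge:
  assumes "a \<in> D"
  shows "odd_faces {edge_of G a} = sym_diff {face_of G a} {face_of G (opp a)}"
proof -
  have e: "{b \<in> f. edge_of G b \<in> {edge_of G a}} = (if a \<in> f then {a} else {}) \<union> (if opp a \<in> f then {opp a} else {})" for f
    by (auto simp: edge_of_eq_iff)
  have "opp a \<noteq> a" using assms by (rule bi.arev_neq)
  then have c: "odd (card {b \<in> f. edge_of G b \<in> {edge_of G a}}) \<longleftrightarrow> (a \<in> f) \<noteq> (opp a \<in> f)" for f
    unfolding e by auto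
  have m: "x \<in> f \<longleftrightarrow> f = face_of G x" if "f \<in> faces G" for f x
    using face_of_mem[OF that, of x] self_in_face[of x] by blast
  have "f \<in> odd_faces {edge_of G a} \<longleftrightarrow> f \<in> sym_diff {face_of G a} {face_of G (opp a)}" for f
  proof (cases "f \<in> faces G")
    case True
    then show ?thesis unfolding odd_faces_def mem_Collect_eq c m[OF True] by (simp, blast)
  next
    case False
    then show ?thesis using face_in_faces[of a] face_in_faces[of "opp a"] assms
      by (auto simp: odd_faces_def)
  qed
  then show ?thesis by blast
qed

text \<open>\<open>S\<close> is a dual path from \<open>r\<close> to \<open>f\<close>, built modulo
  2: passing from \<open>a\<close> to \<open>opp a\<close> adds the edge crossed, and passing on to
  \<open>rot a\<close> costs nothing because it lies on the face of \<open>opp a\<close>.\<close>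

lemma faces_linked:
  assumes "r \<in> faces G" "f \<in> faces G"
  shows "\<exists>S \<subseteq> edges G. odd_faces S = sym_diff {r} {f}"
proof -
  define L where "L f \<longleftrightarrow> (\<exists>S \<subseteq> edges G. odd_faces S = sym_diff {r} {f})" for f
  have L_opp: "L (face_of G (opp a))" if a: "a \<in> D" and L: "L (face_of G a)" for a
  proof -
    obtain S where S: "S \<subseteq> edges G" "odd_faces S = sym_diff {r} {face_of G a}"
      using L unfolding L_def by (elim exE conjE)
    have "odd_faces (sym_diff S {edge_of G a}) = sym_diff {r} {face_of G (opp a)}"
      unfolding odd_faces_sym_diff S(2) odd_faces_edge[OF a] by blast
    moreover have "sym_diff S {edge_of G a} \<subseteq> edges G"
      using S(1) a by (auto simp: edges_def)
    ultimately show ?thesis unfolding L_def by blast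
  qed
  obtain a where a: "a \<in> D" "r = face_of G a" using assms(1) by (rule facesE)
  have "odd_faces {} = {}" by (simp add: odd_faces_def)
  then have L_r: "L (face_of G a)"
    unfolding L_def a(2) by (intro exI[of _ "{}"]) simp
  have "{a \<in> D. L (face_of G a)} = D"
  proof (rule dart_connected)
    show "{a \<in> D. L (face_of G a)} \<noteq> {}" using a(1) L_r by blast
    fix b assume b: "b \<in> {a \<in> D. L (face_of G a)}"
    then show o: "opp b \<in> {a \<in> D. L (face_of G a)}" using L_opp by simp
    have "face_of G (rot b) = face_of G (opp b)"
      using face_phi[of "opp b"] by (simp add: face_succ_def)
    then show "rot b \<in> {a \<in> D. L (face_of G a)}" using o b by simp
  qed simp
  moreover obtain b where "b \<in> D" "f = face_of G b" using assms(2) by (rule facesE)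
  ultimately have "L f" by blast
  then show ?thesis unfolding L_def .
qed

text \<open>The boundary map hits everything once \<open>r\<close> is ignored: dual paths from
  \<open>r\<close> to the members of \<open>A\<close> are added, and \<open>r\<close> absorbs the
  parity.\<close>

lemma ex_odd_faces:
  assumes r: "r \<in> faces G" and "A \<subseteq> faces G - {r}"
  shows "\<exists>S \<subseteq> edges G. odd_faces S - {r} = A"
proof -
  have "finite A" using assms(2) by (rule finite_subset) simp
  then show ?thesis using assms(2)
  proof (induction A)
    case empty
    then show ?case by (intro exI[of _ "{}"]) (simp add: odd_faces_def)
  next
    case (insert f A)
    obtain S where S: "S \<subseteq> edges G" "odd_faces S - {r} = A" using insert by auto
    obtain T where T: "T \<subseteq> edges G" "odd_faces T = sym_diff {r} {f}"
      using faces_linked[OF r, of f] insert by auto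
    have "odd_faces (sym_diff S T) - {r} = sym_diff (odd_faces S - {r}) (odd_faces T - {r})"
      unfolding odd_faces_sym_diff by blast
    also have "\<dots> = insert f A" using S(2) T(2) insert by auto
    finally show ?case using S(1) T(1) by (intro exI[of _ "sym_diff S T"]) blast
  qed
qed

definition even_sets :: "'d set set set" where
  "even_sets = {S. S \<subseteq> edges G \<and> odd_faces S = {}}"

lemma finite_even_sets: "finite even_sets"
  unfolding even_sets_def by simp

text \<open>Rank and nullity as a count: choose one edge set for each prescribed boundary and
  translate it by every element of the kernel; the results are pairwise different.\<close>

lemma card_even_sets: "2 ^ (card (faces G) - 1) * card even_sets \<le> 2 ^ card (edges G)"
proof -
  obtain a where "a \<in> D" using D_nonempty by auto
  then obtain r where r: "r \<in> faces G" using face_in_faces by blast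
  define pick where "pick A = (SOME S. S \<subseteq> edges G \<and> odd_faces S - {r} = A)" for A
  have pick: "pick A \<subseteq> edges G" "odd_faces (pick A) - {r} = A" if "A \<subseteq> faces G - {r}" for A
    using someI_ex[OF ex_odd_faces[OF r that]] unfolding pick_def by auto
  define g where "g = (\<lambda>(A, S). sym_diff (pick A) S)"
  have "card (Pow (faces G - {r}) \<times> even_sets) \<le> card (Pow (edges G))"
  proof (rule card_inj_on_le)
    show "inj_on g (Pow (faces G - {r}) \<times> even_sets)"
    proof (rule inj_onI, clarify)
      fix A S B T
      assume *: "A \<subseteq> faces G - {r}" "B \<subseteq> faces G - {r}" "S \<in> even_sets" "T \<in> even_sets"
        "g (A, S) = g (B, T)"
      have e: "odd_faces S = {}" "odd_faces T = {}" using * by (auto simp: even_sets_def)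
      have "odd_faces (g (A, S)) - {r} = A" "odd_faces (g (B, T)) - {r} = B"
        unfolding g_def prod.case odd_faces_sym_diff e using pick *(1,2) by simp_all
      then have "A = B" using *(5) by simp
      then have "S = T" using *(5) unfolding g_def prod.case by (auto intro: sym_diff_cancel)
      then show "A = B \<and> S = T" using \<open>A = B\<close> by simp
    qed
    show "g ` (Pow (faces G - {r}) \<times> even_sets) \<subseteq> Pow (edges G)"
    proof (clarify)
      fix A S e assume AS: "A \<subseteq> faces G - {r}" "S \<in> even_sets" and "e \<in> g (A, S)"
      then have "e \<in> sym_diff (pick A) S" by (simp add: g_def)
      moreover have "S \<subseteq> edges G" using AS(2) by (simp add: even_sets_def)
      ultimately show "e \<in> edges G" using pick(1)[OF AS(1)] by blast
    qed
  qed simp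
  then show ?thesis
    using r by (simp add: card_cartesian_product card_Pow)
qed

text \<open>On each face, \<open>phi\<close> maps the darts with head in \<open>U\<close>
  bijectively onto those with tail in \<open>U\<close>. The cut darts form the symmetric difference
  of these two equally large sets.\<close>

lemma edge_cut_even: "edge_cut U \<in> even_sets"
proof -
  have mem: "edge_of G a \<in> edge_cut U \<longleftrightarrow> (src a \<in> U) \<noteq> (dst a \<in> U)" if "a \<in> D" for a
    using that unfolding edge_cut_def by (auto simp: edge_of_eq_iff)
  have "even (card {a \<in> f. edge_of G a \<in> edge_cut U})" if f: "f \<in> faces G" for f
  proof -
    obtain b where b: "b \<in> D" "f = face_of G b" using f by (rule facesE)
    let ?X = "{a \<in> f. src a \<in> U}" and ?Y = "{a \<in> f. dst a \<in> U}"
    have "{a \<in> f. edge_of G a \<in> edge_cut U} = sym_diff ?X ?Y"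
      using mem mem_face_in[OF f] by blast
    moreover have "bij_betw phi ?Y ?X"
    proof (rule bij_betw_imageI)
      show "inj_on phi ?Y" by (simp add: inj_on_def phi_inj)
      have im: "phi ` f = f" using phi_bij_face[of b] b(2) by (simp add: bij_betw_def)
      have "src (phi a) = dst a" if "a \<in> f" for a using mem_face_in[OF f that] by simp
      then have "phi ` ?Y = {x \<in> phi ` f. src x \<in> U}" by auto
      then show "phi ` ?Y = ?X" unfolding im .
    qed
    then have "card ?Y = card ?X" by (rule bij_betw_same_card)
    moreover have "finite ?X" "finite ?Y" using f by simp_all
    ultimately show ?thesis using odd_card_sym_diff[of ?X ?Y] by simp
  qed
  moreover have "edge_cut U \<subseteq> edges G" by (auto simp: edge_cut_def edges_def)
  ultimately show ?thesis by (auto simp: even_sets_def odd_faces_def)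
qed

lemma edge_in_cut_iff: "a \<in> D \<Longrightarrow> edge_of G a \<in> edge_cut U \<longleftrightarrow> (src a \<in> U) \<noteq> (dst a \<in> U)"
  unfolding edge_cut_def by (auto simp: edge_of_eq_iff)

text \<open>Equal cuts make the symmetric difference of the two sets closed under adjacency, hence
  empty or all of \<open>V\<close>. Leaving out \<open>v\<close> rules out the latter, that is,
  complementary sets.\<close>

lemma edge_cut_inj: "v \<in> V \<Longrightarrow> inj_on edge_cut (Pow (V - {v}))"
proof (rule inj_onI)
  fix U W assume v: "v \<in> V" and UW: "U \<in> Pow (V - {v})" "W \<in> Pow (V - {v})" and eq: "edge_cut U = edge_cut W"
  show "U = W"
  proof (rule ccontr)
    assume "U \<noteq> W"
    have "sym_diff U W = V"
    proof (rule vertex_connected)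
      show "dst a \<in> sym_diff U W" if "a \<in> D" "src a \<in> sym_diff U W" for a
        using edge_in_cut_iff[OF that(1), of U] edge_in_cut_iff[OF that(1), of W] that(2) eq by auto
    qed (use UW \<open>U \<noteq> W\<close> in blast)+
    then show False using v UW by blast
  qed
qed

lemma even_set_is_cut:
  assumes "S \<in> even_sets"
  obtains U where "U \<subseteq> V" "S = edge_cut U"
proof -
  obtain v where v: "v \<in> V" using V_nonempty by auto
  let ?P = "Pow (V - {v})"
  obtain a where "a \<in> D" using D_nonempty by auto
  then have "faces G \<noteq> {}" using face_in_faces by blast
  then have F: "card (faces G) \<ge> 1" by (simp add: Suc_leI card_gt_0_iff)
  have Vc: "card V \<ge> 1" using v by (metis One_nat_def Suc_leI card_gt_0_iff empty_iff gr.finite_verts)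
  \<comment> \<open>Genus 0 enters here: on a torus, the edges crossed by a dual cycle that does not
    separate form an even set that is no cut.\<close>
  have "card (edges G) = (card (faces G) - 1) + (card V - 1)"
    using euler F Vc by linarith
  then have "2 ^ (card (faces G) - 1) * card even_sets \<le> 2 ^ (card (faces G) - 1) * (2 ^ (card V - 1) :: nat)"
    using card_even_sets by (simp add: power_add)
  then have "card even_sets \<le> 2 ^ (card V - 1)" by simp
  also have "\<dots> = card (edge_cut ` ?P)"
    using edge_cut_inj[OF v] v by (simp add: card_image card_Pow)
  finally have "edge_cut ` ?P = even_sets"
    by (intro card_seteq[OF finite_even_sets]) (auto simp: edge_cut_even)
  then obtain U where "U \<in> ?P" "S = edge_cut U" using assms by blast
  then show ?thesis using that by blast
qed

end

section \<open>Fullerenes\<close>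

locale fullerene_map =
  fixes G :: "('v, 'd) embedded_graph"
  assumes fullerene: "fullerene G"

sublocale fullerene_map \<subseteq> plane_map G
  using fullerene by unfold_locales (simp add: fullerene_def)

context fullerene_map
begin

lemma card_out_arcs: "v \<in> V \<Longrightarrow> card (out_arcs (graph_of G) v) = 3"
  using fullerene by (simp add: fullerene_def out_degree_def)

lemma rot_permutation: "permutation rot"
  using rot_permutes gr.finite_arcs by (metis permutation_permutes)

lemma rot_orbit: assumes "a \<in> D" shows "(rot ^^ 3) a = a" "orbit rot a = {a, rot a, rot (rot a)}" "card (orbit rot a) = 3"
proof -
  have s: "a \<in> orbit rot a" by (rule permutation_self_in_orbit[OF rot_permutation])
  show c: "card (orbit rot a) = 3"
    using card_out_arcs[of "src a"] assms by (simp add: out_orbit)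
  have "card (orbit rot a) = funpow_dist1 rot a a"
    unfolding orbit_conv_funpow_dist1[OF s]
    using inj_on_funpow_dist1[OF s] by (simp add: card_image)
  then show 3: "(rot ^^ 3) a = a" using funpow_dist1_prop[OF s] c by simp
  have "orbit rot a = {(rot ^^ m) a |m. m < 3}"
    by (rule orbit_altdef_bounded[OF 3]) simp
  also have "\<dots> = {a, rot a, rot (rot a)}"
    by (auto simp: less_Suc_eq numeral_3_eq_3) (metis funpow_0, metis funpow_0 funpow.simps(2) comp_apply lessI, metis funpow_0 funpow.simps(2) comp_apply lessI)
  finally show "orbit rot a = {a, rot a, rot (rot a)}" .
qed

lemma rot3 [simp]: "rot (rot (rot a)) = a"
proof (cases "a \<in> D")
  case True
  then show ?thesis using rot_orbit(1)[of a] by (simp add: numeral_3_eq_3)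
next
  case False
  then show ?thesis using rot_permutes by (simp add: permutes_not_in)
qed

lemma rot_neq: assumes "a \<in> D" shows "rot a \<noteq> a" "rot (rot a) \<noteq> a" "rot (rot a) \<noteq> rot a"
proof -
  have *: "card {a, rot a, rot (rot a)} = 3" using rot_orbit[OF assms] by simp
  show 1: "rot a \<noteq> a" using * by (auto simp: card_insert_if split: if_splits)
  show "rot (rot a) \<noteq> rot a" using 1 by (simp add: rot_inj)
  show "rot (rot a) \<noteq> a" using * by (auto simp: card_insert_if split: if_splits)
qed

lemma same_src: assumes "a \<in> D" "b \<in> D" "src b = src a" shows "b = a \<or> b = rot a \<or> b = rot (rot a)"
  using same_src_orbit[OF assms(1,2)] rot_orbit(2)[OF assms(1)] assms(3) by simp

lemma face_gon: "a \<in> D \<Longrightarrow> is_gon 5 G (face_of G a) \<or> is_gon 6 G (face_of G a)"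
  using fullerene face_in_faces by (auto simp: fullerene_def)

lemma card_face: "a \<in> D \<Longrightarrow> card (face_of G a) = 5 \<or> card (face_of G a) = 6"
  using face_gon by (auto simp: is_gon_def)

lemma face_src_inj: "a \<in> D \<Longrightarrow> b \<in> face_of G a \<Longrightarrow> src b = src a \<Longrightarrow> b = a"
  using face_gon[of a] self_in_face[of a] unfolding is_gon_def by (metis inj_onD)

text \<open>Otherwise \<open>phi a\<close> and \<open>opp a\<close> would be darts of one face with
  a common tail, hence equal; but \<open>phi a\<close> is \<open>rot (opp a)\<close>, and
  \<open>rot\<close> fixes no dart of a cubic graph.\<close>

lemma opp_notin_face: assumes "a \<in> D" shows "opp a \<notin> face_of G a"
proof
  assume o: "opp a \<in> face_of G a"
  then have e: "face_of G (opp a) = face_of G a" by (simp add: face_eq_iff)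
  have "phi a = opp a"
    by (rule face_src_inj[of "opp a"]) (use assms in \<open>simp_all add: e\<close>)
  then show False using rot_neq(1)[of "opp a"] assms by (simp add: face_succ_def)
qed

section \<open>Edge cuts with one or two edges\<close>

definition into :: "'v set \<Rightarrow> 'd set" where
  "into U = {x \<in> D. src x \<notin> U \<and> dst x \<in> U}"

lemma face_exit:
  assumes "a \<in> into U"
  obtains k where "0 < k" "k < card (face_of G a)" "opp ((phi ^^ k) a) \<in> into U"
proof -
  let ?n = "card (face_of G a)"
  have a: "a \<in> D" "src a \<notin> U" "dst a \<in> U" using assms by (auto simp: into_def)
  have n: "?n > 0" using card_face[OF a(1)] by auto
  have ex: "\<exists>k<?n. dst ((phi ^^ k) a) \<notin> U"
  proof (rule ccontr)
    assume "\<not> ?thesis"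
    then have "dst ((phi ^^ (?n - 1)) a) \<in> U" using n by simp
    then have "src (phi ((phi ^^ (?n - 1)) a)) \<in> U" using a(1) by simp
    moreover have "phi ((phi ^^ (?n - 1)) a) = (phi ^^ ?n) a"
      using n by (metis Suc_diff_1 comp_apply funpow.simps(2))
    ultimately show False using funpow_card_face[OF a(1)] a(2) by simp
  qed
  define k where "k = (LEAST k. dst ((phi ^^ k) a) \<notin> U)"
  have k: "dst ((phi ^^ k) a) \<notin> U" "k < ?n"
    using ex LeastI_ex[of "\<lambda>k. dst ((phi ^^ k) a) \<notin> U"] Least_le[of "\<lambda>k. dst ((phi ^^ k) a) \<notin> U"]
    unfolding k_def by (blast, meson le_less_trans)
  have k0: "0 < k" using k(1) a(3) by (cases k) auto
  then obtain m where m: "k = Suc m" by (cases k) auto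
  have "dst ((phi ^^ m) a) \<in> U" using not_less_Least[of m "\<lambda>k. dst ((phi ^^ k) a) \<notin> U"] m unfolding k_def by auto
  then have "src ((phi ^^ k) a) \<in> U" unfolding m using a(1) by simp
  then have "opp ((phi ^^ k) a) \<in> into U" using k(1) a(1) by (simp add: into_def)
  then show ?thesis using that k0 k(2) by blast
qed

text \<open>The face that enters \<open>U\<close> along \<open>a\<close> must leave it again, and
  not through the edge of \<open>a\<close>, whose two sides are different faces. So it leaves
  through \<open>b\<close>; the number \<open>k\<close> of vertices of \<open>U\<close> passed on
  the way is what the descent controls.\<close>

lemma two_cut_exit:
  assumes "into U = {a, b}"
  obtains k where "0 < k" "k < card (face_of G a)" "(phi ^^ k) a = opp b"
proof -
  have a: "a \<in> into U" "a \<in> D" using assms by (auto simp: into_def)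
  obtain k where k: "0 < k" "k < card (face_of G a)" "opp ((phi ^^ k) a) \<in> into U"
    using a(1) by (rule face_exit)
  have "(phi ^^ k) a \<in> face_of G a" by (simp add: face_eq_iff)
  then have "opp ((phi ^^ k) a) \<noteq> a" using opp_notin_face[OF a(2)] by (metis opp_opp)
  then have "opp ((phi ^^ k) a) = b" using k(3) assms by auto
  then show ?thesis using that k by (metis opp_opp)
qed

text \<open>A bridge would have to serve as its own exit and so have the same face on both
  sides.\<close>

lemma no_bridge: "into U \<noteq> {a}"
proof
  assume "into U = {a}"
  then have "into U = {a, a}" by simp
  then obtain k where "(phi ^^ k) a = opp a" by (rule two_cut_exit)
  then have "opp a \<in> face_of G a" by (metis face_eq_iff face_funpow)
  moreover have "a \<in> D" using \<open>into U = {a}\<close> by (auto simp: into_def)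
  ultimately show False using opp_notin_face by blast
qed

lemma intoD: "into U = {a, b} \<Longrightarrow> a \<in> D \<and> b \<in> D \<and> src a \<notin> U \<and> src b \<notin> U \<and> dst a \<in> U \<and> dst b \<in> U"
  by (auto simp: into_def)

lemma two_cut_inner:
  assumes "into U = {a, b}" "x \<in> D" "src x \<in> U" "x \<noteq> opp a" "x \<noteq> opp b"
  shows "dst x \<in> U"
proof (rule ccontr)
  assume "dst x \<notin> U"
  then have "opp x \<in> into U" using assms(2,3) by (simp add: into_def)
  then have "opp x \<in> {a, b}" by (simp only: assms(1))
  then show False using assms(4,5) by auto
qed

text \<open>Both cut edges would end at one vertex of \<open>U\<close>. Without that vertex, the
  only edge entering the rest is its third edge, a bridge.\<close>

lemma two_cut_neq_1:
  assumes U: "into U = {a, b}" and ab: "phi a = opp b"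
  shows False
proof -
  have i: "a \<in> D" "b \<in> D" "src a \<notin> U" "src b \<notin> U" "dst a \<in> U" "dst b \<in> U"
    using intoD[OF U] by auto
  define d where "d = rot (opp b)"
  have uu: "dst b = dst a" using i ab by (metis src_opp src_phi)
  have ra: "rot (opp a) = opp b" using ab by (simp add: face_succ_def)
  have dD: "d \<in> D" "src d = dst a" using i uu by (simp_all add: d_def)
  have dn: "d \<noteq> opp a" "d \<noteq> opp b"
    using rot_neq[of "opp a"] i unfolding d_def ra[symmetric] by auto
  have dU: "dst d \<in> U" using two_cut_inner[OF U dD(1)] dD dn i by simp
  have "x \<in> into (U - {dst a}) \<longleftrightarrow> x = d" for x
  proof
    assume "x = d"
    then show "x \<in> into (U - {dst a})" using dD dU src_neq_dst[OF dD(1)] by (auto simp: into_def)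
  next
    assume x: "x \<in> into (U - {dst a})"
    have "src x \<in> U"
    proof (rule ccontr)
      assume "src x \<notin> U"
      then have "x \<in> into U" using x by (auto simp: into_def)
      then show False using x U uu by (auto simp: into_def)
    qed
    then have "src x = src (opp a)" using x i by (auto simp: into_def)
    then have "x = opp a \<or> x = opp b \<or> x = d"
      using same_src[of "opp a" x] x i ra by (auto simp: into_def d_def)
    moreover have "x \<noteq> opp a" "x \<noteq> opp b" using x i by (auto simp: into_def)
    ultimately show "x = d" by simp
  qed
  then have "into (U - {dst a}) = {d}" by blast
  then show False using no_bridge by blast
qed

text \<open>The return time is a multiple of the face length and, since \<open>i\<close> is at most
  5 and no face is shorter than that, less than twice this length.\<close>

lemma dvd_face_le:
  assumes "a \<in> D" "(phi ^^ (j + i)) a = a" "j < card (face_of G a)" "i \<le> 5"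
  shows "j + i \<le> 6"
proof -
  have "card (face_of G a) dvd j + i" using assms(1,2) by (rule funpow_return_dvd)
  then obtain q where q: "j + i = card (face_of G a) * q" by (elim dvdE)
  show ?thesis
  proof (cases "q \<le> 1")
    case True
    then show ?thesis using q card_face[OF assms(1)] by (cases q) auto
  next
    case False
    then have "card (face_of G a) * 2 \<le> j + i" unfolding q by simp
    then show ?thesis using assms(3,4) card_face[OF assms(1)] by auto
  qed
qed

text \<open>The descent: if a two-edge cut \<open>{a, b}\<close> is crossed by faces with \<open>k\<close> and \<open>l\<close> vertices in \<open>U\<close>, where
  \<open>k + l \<le> 6\<close>, then a ladder step (\<open>k = 2\<close>) or the removal of a 4-cycle (\<open>k = l = 3\<close>) yields a smaller such
  cut. The bound survives because no face has more than six edges.\<close>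

lemma two_cut_step_2:
  assumes U: "into U = {a, b}" and ab: "phi (phi a) = opp b" and ba: "(phi ^^ l) b = opp a"
    and l: "0 < l" "l \<le> 4"
  obtains d e j where "into (U - {dst a, dst b}) = {d, e}"
    "(phi ^^ j) d = opp e" "(phi ^^ (l - 2)) e = opp d" "0 < j" "j \<le> 4" "2 < l"
proof -
  have i: "a \<in> D" "b \<in> D" "src a \<notin> U" "src b \<notin> U" "dst a \<in> U" "dst b \<in> U"
    using intoD[OF U] by auto
  \<comment> \<open>The edge of \<open>p\<close> joins the two vertices of \<open>U\<close> at which
    \<open>a\<close> and \<open>b\<close> arrive; \<open>d\<close> and \<open>e\<close> are the
    third edges at these vertices and form the next cut.\<close>
  define p where "p = phi a"
  define d where "d = rot p"
  define e where "e = rot (opp b)"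
  define W where "W = U - {dst a, dst b}"
  have pD: "p \<in> D" "src p = dst a" "dst p = dst b"
    using i ab by (auto simp: p_def) (metis phi_in src_opp src_phi)
  have pr: "rot (opp a) = p" "rot (opp p) = opp b" using ab by (simp_all add: p_def face_succ_def)
  have uu: "dst a \<noteq> dst b" using src_neq_dst[OF pD(1)] pD by simp
  have dD: "d \<in> D" "src d = dst a" "e \<in> D" "src e = dst b" using i pD by (simp_all add: d_def e_def)
  have dn: "d \<noteq> opp a" "d \<noteq> p" "e \<noteq> opp b" "e \<noteq> opp p"
    using rot_neq[of "opp a"] rot_neq[of "opp p"] i pD unfolding d_def e_def pr[symmetric] by auto
  have dn2: "d \<noteq> opp b" "e \<noteq> opp a" using uu dD i by auto
  have dU: "dst d \<in> U" "dst e \<in> U"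
    using two_cut_inner[OF U dD(1)] two_cut_inner[OF U dD(3)] dD dn dn2 i by simp_all
  have "dst d \<noteq> dst b" using no_multi[OF dD(1) pD(1)] dn(2) dD(2) pD by auto
  moreover have "dst d \<noteq> dst a" using src_neq_dst[OF dD(1)] dD by simp
  ultimately have dW: "d \<in> into W" using dU dD by (auto simp: into_def W_def)
  have "dst e \<noteq> dst a" using no_multi[OF dD(3), of "opp p"] dn(4) dD(4) pD by auto
  moreover have "dst e \<noteq> dst b" using src_neq_dst[OF dD(3)] dD by simp
  ultimately have eW: "e \<in> into W" using dU dD by (auto simp: into_def W_def)
  have "x = d \<or> x = e" if x: "x \<in> into W" for x
  proof -
    have xx: "x \<in> D" "dst x \<in> U" "dst x \<noteq> dst a" "dst x \<noteq> dst b" "src x \<notin> U \<or> src x = dst a \<or> src x = dst b"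
      using x by (auto simp: into_def W_def)
    have "src x \<in> U"
    proof (rule ccontr)
      assume "src x \<notin> U"
      then have "x \<in> into U" using xx by (auto simp: into_def)
      then show False using xx U by auto
    qed
    then consider "src x = dst a" | "src x = dst b" using xx by auto
    then show ?thesis
    proof cases
      case 1
      then have "x = opp a \<or> x = p \<or> x = d"
        using same_src[of "opp a" x] xx i pr by (auto simp: d_def)
      moreover have "x \<noteq> opp a" "x \<noteq> p" using xx i pD by auto
      ultimately show ?thesis by simp
    next
      case 2
      then have "x = opp p \<or> x = opp b \<or> x = e"
        using same_src[of "opp p" x] xx i pD pr by (auto simp: e_def)
      moreover have "x \<noteq> opp b" "x \<noteq> opp p" using xx i pD by auto
      ultimately show ?thesis by simp
    qed
  qed
  then have into: "into W = {d, e}" using dW eW by blast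
  have phi_b: "phi b = e" by (simp add: face_succ_def e_def)
  have phi_d: "phi (opp d) = opp a" using pr by (simp add: face_succ_def d_def flip: pr(1))
  have l1: "l \<noteq> 1" using ba phi_b dn2 by auto
  \<comment> \<open>With \<open>l = 2\<close> the darts \<open>d\<close> and \<open>e\<close> would
    be opposite, yet both enter \<open>W\<close>.\<close>
  have l2: "l \<noteq> 2"
  proof
    assume "l = 2"
    then have "phi e = phi (opp d)" using ba phi_b phi_d by (simp add: numeral_2_eq_2)
    then have "e = opp d" by (simp add: phi_inj)
    then show False using dD dW by (auto simp: into_def W_def)
  qed
  then obtain m where m: "l = Suc (Suc m)" "l - 2 = m" "2 < l" using l l1
    by (metis One_nat_def add_2_eq_Suc le_add_diff_inverse less_2_cases_iff less_one not_less_iff_gr_or_eq linorder_not_less less_imp_le)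
  have "phi ((phi ^^ m) (phi b)) = phi (opp d)" using ba phi_d unfolding m(1) by (simp add: funpow_swap1)
  then have me: "(phi ^^ m) e = opp d" by (simp add: phi_inj phi_b)
  obtain j where j: "0 < j" "j < card (face_of G d)" "(phi ^^ j) d = opp e"
    using into by (rule two_cut_exit)
  \<comment> \<open>The face of \<open>d\<close> closes up through the reversed \<open>p\<close>.
    Its length bounds \<open>j + 2\<close> by 6, whatever happened on the far side of the old
    cut.\<close>
  have "phi (opp e) = opp p" "phi (opp p) = d"
    by (simp_all add: face_succ_def e_def d_def flip: pr(2))
  then have "(phi ^^ (j + 2)) d = d" using j(3) by simp
  then have "j \<le> 4" using dvd_face_le[OF dD(1)] j(2) by fastforce
  then show ?thesis using that[of d e j] into j me m by (simp add: W_def)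
qed

text \<open>The edges of \<open>phi a\<close>, \<open>phi (phi a)\<close>, \<open>phi b\<close>,
  \<open>phi (phi b)\<close> form a 4-cycle. Its vertices have third edges \<open>a\<close>,
  \<open>d\<close>, \<open>b\<close>, \<open>e\<close> in cyclic order, where \<open>e\<close> is
  \<open>rot (phi (phi b))\<close>, so removing the cycle leaves the cut \<open>{d, e}\<close>. Only
  the claims about \<open>d\<close> are made: exchanging \<open>a\<close> and \<open>b\<close> gives
  those about \<open>e\<close>.\<close>

lemma two_cut_side_3:
  assumes U: "into U = {a, b}" and ab: "phi (phi (phi a)) = opp b" and ba: "phi (phi (phi b)) = opp a"
  defines "d \<equiv> rot (phi (phi a))" and "W \<equiv> U - {dst a, dst b, dst (phi a), dst (phi b)}"
  shows "d \<in> into W" "src d = dst (phi a)"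
    "phi (phi (phi (opp (rot (phi (phi b)))))) = d"
    "\<And>z. z \<in> into W \<Longrightarrow> src z = dst a \<Longrightarrow> False"
    "\<And>z. z \<in> into W \<Longrightarrow> src z = dst (phi a) \<Longrightarrow> z = d"
proof -
  have i: "a \<in> D" "b \<in> D" "src a \<notin> U" "src b \<notin> U" "dst a \<in> U" "dst b \<in> U"
    using intoD[OF U] by auto
  define p1 p2 q1 q2 e where "p1 = phi a" and "p2 = phi p1" and "q1 = phi b" and "q2 = phi q1" and "e = rot q2"
  note defs = p1_def p2_def q1_def q2_def
  have d: "d = rot p2" by (simp add: d_def defs)
  have pD: "p1 \<in> D" "p2 \<in> D" "q1 \<in> D" "q2 \<in> D" "d \<in> D" "e \<in> D" using i by (simp_all add: defs d_def e_def)
  have src: "src p1 = dst a" "src p2 = dst p1" "src q1 = dst b" "src q2 = dst q1" "src d = dst p1" "src e = dst q1"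
    using i pD by (simp_all add: p1_def p2_def q1_def q2_def d e_def)
  have "src (phi p2) = dst p2" "src (phi q2) = dst q2" using pD by simp_all
  then have dst: "dst p2 = dst b" "dst q2 = dst a" using ab ba i by (simp_all add: defs)
  have r: "rot (opp a) = p1" "rot (opp p1) = p2" "rot (opp p2) = opp b"
    "rot (opp b) = q1" "rot (opp q1) = q2" "rot (opp q2) = opp a"
    using ab ba by (simp_all add: defs face_succ_def)
  have r': "rot p1 = opp q2" "rot d = opp p1" "rot q1 = opp p2" "rot e = opp q1"
    unfolding d e_def using rot3 r by metis+
  have n1: "dst a \<noteq> dst p1" "dst p1 \<noteq> dst b" "dst b \<noteq> dst q1" "dst q1 \<noteq> dst a"
    using src_neq_dst[OF pD(1)] src_neq_dst[OF pD(2)] src_neq_dst[OF pD(3)] src_neq_dst[OF pD(4)] src dst by auto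
  \<comment> \<open>If opposite corners of the 4-cycle coincided, the face of \<open>p1\<close>
    would have length at most 2.\<close>
  have n2: "dst a \<noteq> dst b"
  proof
    assume e: "dst a = dst b"
    have pp: "phi (phi p1) = opp b" using ab by (simp add: defs)
    then have f: "opp b \<in> face_of G p1" by (metis face_eq_iff face_phi)
    then have "opp b = p1" using face_src_inj[OF pD(1) f] e src i by simp
    then have "(phi ^^ 2) p1 = p1" using pp by (simp add: numeral_2_eq_2)
    then have "card (face_of G p1) dvd 2" by (rule funpow_return_dvd[OF pD(1)])
    then show False using card_face[OF pD(1)] by (auto dest: dvd_imp_le)
  qed
  have n3: "dst p1 \<noteq> dst q1"
  proof
    assume "dst p1 = dst q1"
    then have "q2 = opp p1" using no_multi[OF pD(4), of "opp p1"] pD src dst by simp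
    then have "rot p1 = p1" using r' by simp
    then show False using rot_neq pD by blast
  qed
  have "p1 \<noteq> opp a" using rot_neq(1)[of "opp a"] r(1) i by auto
  moreover have "p1 \<noteq> opp b" using n2 src i by auto
  ultimately have xU: "dst p1 \<in> U" using two_cut_inner[OF U pD(1)] src i by simp
  have "d \<noteq> opp a" "d \<noteq> opp b" using n1 src i by auto
  then have dU: "dst d \<in> U" using two_cut_inner[OF U pD(5)] src xU by simp
  have d1: "dst d \<noteq> dst a"
  proof
    assume "dst d = dst a"
    then have "d = opp p1" using no_multi[OF pD(5), of "opp p1"] pD src by simp
    then show False using r'(2) rot_neq(1)[OF pD(5)] by simp
  qed
  have d2: "dst d \<noteq> dst b"
  proof
    assume "dst d = dst b"
    then have "d = p2" using no_multi[OF pD(5) pD(2)] src dst by simp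
    then show False using d rot_neq(1)[OF pD(2)] by simp
  qed
  have d3: "dst d \<noteq> dst p1" using src_neq_dst[OF pD(5)] src by simp
  have fe: "phi (phi (phi (opp e))) = d" using r' by (simp add: face_succ_def d)
  then show "phi (phi (phi (opp (rot (phi (phi b)))))) = d" by (simp add: e_def defs)
  \<comment> \<open>Otherwise \<open>d\<close> and \<open>e\<close> would be the two darts of one
    edge, and the face of \<open>d\<close> would close after 3 steps.\<close>
  have d4: "dst d \<noteq> dst q1"
  proof
    assume "dst d = dst q1"
    then have "opp d = opp q1 \<or> opp d = q2 \<or> opp d = e"
      using same_src[of "opp q1" "opp d"] pD src r by (simp add: e_def)
    moreover have "opp d \<noteq> opp q1" "opp d \<noteq> q2" using n1 src dst pD by (auto simp: bi.arev_eq_iff)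
    ultimately have "opp d = e" by simp
    then have "opp e = d" by auto
    then have "(phi ^^ 3) d = d" using fe by (simp add: numeral_3_eq_3)
    then have "card (face_of G d) dvd 3" by (rule funpow_return_dvd[OF pD(5)])
    then show False using card_face[OF pD(5)] by (auto dest: dvd_imp_le)
  qed
  show "d \<in> into W" using pD(5) src dU d1 d2 d3 d4 by (simp add: into_def W_def defs)
  show "src d = dst (phi a)" using src by (simp add: defs)
  fix z assume z: "z \<in> into W"
  have zz: "z \<in> D" "dst z \<in> U" "dst z \<noteq> dst a" "dst z \<noteq> dst b" "dst z \<noteq> dst p1" "dst z \<noteq> dst q1"
    using z by (simp_all add: into_def W_def defs)
  {
    assume "src z = dst a"
    then have "z = opp a \<or> z = p1 \<or> z = opp q2"
      using same_src[of "opp a" z] zz i r r' by simp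
    moreover have "z \<noteq> opp a" "z \<noteq> p1" "z \<noteq> opp q2" using zz i pD src by auto
    ultimately show False by simp
  next
    assume "src z = dst (phi a)"
    then have "z = opp p1 \<or> z = p2 \<or> z = d"
      using same_src[of "opp p1" z] zz pD r by (simp add: d flip: p1_def)
    moreover have "z \<noteq> opp p1" "z \<noteq> p2" using zz pD src dst by auto
    ultimately show "z = d" by simp
  }
qed

lemma two_cut_step_3:
  assumes U: "into U = {a, b}" and ab: "phi (phi (phi a)) = opp b" and ba: "phi (phi (phi b)) = opp a"
  obtains d e j l where "into (U - {dst a, dst b, dst (phi a), dst (phi b)}) = {d, e}"
    "(phi ^^ j) d = opp e" "(phi ^^ l) e = opp d" "0 < j" "j \<le> 3" "0 < l" "l \<le> 3"
proof -
  define d e W where "d = rot (phi (phi a))" and "e = rot (phi (phi b))"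
    and "W = U - {dst a, dst b, dst (phi a), dst (phi b)}"
  have U': "into U = {b, a}" using U by auto
  have W: "W = U - {dst b, dst a, dst (phi b), dst (phi a)}" by (auto simp: W_def)
  note A = two_cut_side_3[OF U ab ba, folded d_def e_def W_def]
  note B = two_cut_side_3[OF U' ba ab, folded d_def e_def, folded W]
  have "z = d \<or> z = e" if z: "z \<in> into W" for z
  proof -
    have "src z \<in> U"
    proof (rule ccontr)
      assume "src z \<notin> U"
      then have "z \<in> into U" using z by (auto simp: into_def W_def)
      then have "z = a \<or> z = b" using U by simp
      then show False using z by (auto simp: into_def W_def)
    qed
    then have "src z = dst a \<or> src z = dst b \<or> src z = dst (phi a) \<or> src z = dst (phi b)"
      using z by (auto simp: into_def W_def)
    then show ?thesis using A(4,5)[OF z] B(4,5)[OF z] by blast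
  qed
  then have into: "into W = {d, e}" using A(1) B(1) by blast
  then have into': "into W = {e, d}" by auto
  have D: "d \<in> D" "e \<in> D" using A(1) B(1) by (simp_all add: into_def)
  obtain j where j: "0 < j" "j < card (face_of G d)" "(phi ^^ j) d = opp e"
    using into by (rule two_cut_exit)
  obtain l where l: "0 < l" "l < card (face_of G e)" "(phi ^^ l) e = opp d"
    using into' by (rule two_cut_exit)
  \<comment> \<open>Three further steps along the removed 4-cycle close the face of
    \<open>d\<close>, which gives \<open>j + 3\<close> at most 6; the same holds for
    \<open>l\<close> and \<open>e\<close>.\<close>
  have "(phi ^^ (j + 3)) d = d" using A(3) j(3) by (simp add: funpow_add add.commute[of j] numeral_3_eq_3)
  then have "j + 3 \<le> 6" using dvd_face_le[OF D(1)] j(2) by simp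
  moreover have "(phi ^^ (l + 3)) e = e" using B(3) l(3) by (simp add: funpow_add add.commute[of l] numeral_3_eq_3)
  then have "l + 3 \<le> 6" using dvd_face_le[OF D(2)] l(2) by simp
  ultimately show ?thesis using that[of d e j l] into j l by (simp add: W_def)
qed

lemma no_short_two_cut:
  assumes "finite U" "into U = {a, b}" "(phi ^^ k) a = opp b" "(phi ^^ l) b = opp a" "0 < k" "0 < l" "k + l \<le> 6"
  shows False
  using assms
proof (induction "card U" arbitrary: U a b k l rule: less_induct)
  case less
  have i: "dst a \<in> U" using intoD[OF less.prems(2)] by auto
  have IH: "False" if "into W = {d, e}" "W \<subseteq> U - {dst a}" "(phi ^^ j) d = opp e" "(phi ^^ m) e = opp d"
      "0 < j" "0 < m" "j + m \<le> 6" for W d e j m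
  proof (rule less.hyps)
    have "W \<subset> U" using i that(2) by blast
    then show "card W < card U" using less.prems(1) by (rule psubset_card_mono[rotated])
    show "finite W" using less.prems(1) that(2) by (meson Diff_subset finite_subset)
  qed (use that in auto)
  have U': "into U = {b, a}" using less.prems(2) by auto
  \<comment> \<open>If both numbers are at least 3, the bound 6 forces equality. In the ladder cases
    the new sum is at most 4 + 2, in the last case at most 3 + 3, so the bound is inherited.\<close>
  consider "k = 1" | "l = 1" | "k = 2" "l \<le> 4" | "l = 2" "k \<le> 4" | "k = 3" "l = 3"
    using less.prems(5-7) by linarith
  then show ?case
  proof cases
    case 1
    then show ?thesis using two_cut_neq_1[OF less.prems(2)] less.prems(3) by simp
  next
    case 2
    then show ?thesis using two_cut_neq_1[OF U'] less.prems(4) by simp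
  next
    case 3
    then have "phi (phi a) = opp b" using less.prems(3) by (simp add: numeral_2_eq_2)
    then obtain d e j where "into (U - {dst a, dst b}) = {d, e}"
      "(phi ^^ j) d = opp e" "(phi ^^ (l - 2)) e = opp d" "0 < j" "j \<le> 4" "2 < l"
      using two_cut_step_2[OF less.prems(2) _ less.prems(4,6) 3(2)] by metis
    then show ?thesis using 3 by (intro IH[of "U - {dst a, dst b}" d e j "l - 2"]) auto
  next
    case 4
    then have "phi (phi b) = opp a" using less.prems(4) by (simp add: numeral_2_eq_2)
    then obtain d e j where "into (U - {dst b, dst a}) = {d, e}"
      "(phi ^^ j) d = opp e" "(phi ^^ (k - 2)) e = opp d" "0 < j" "j \<le> 4" "2 < k"
      using two_cut_step_2[OF U' _ less.prems(3,5) 4(2)] by metis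
    then show ?thesis using 4 by (intro IH[of "U - {dst b, dst a}" d e j "k - 2"]) auto
  next
    case 5
    then have "phi (phi (phi a)) = opp b" "phi (phi (phi b)) = opp a"
      using less.prems(3,4) by (simp_all add: numeral_3_eq_3)
    then obtain d e j m where "into (U - {dst a, dst b, dst (phi a), dst (phi b)}) = {d, e}"
      "(phi ^^ j) d = opp e" "(phi ^^ m) e = opp d" "0 < j" "j \<le> 3" "0 < m" "m \<le> 3"
      using two_cut_step_3[OF less.prems(2)] by metis
    then show ?thesis
      by (intro IH[of "U - {dst a, dst b, dst (phi a), dst (phi b)}" d e j m]) auto
  qed
qed

lemma no_two_cut:
  assumes "U \<subseteq> V" "into U = {a, b}" shows False
proof -
  have i: "a \<in> D" "b \<in> D" "src a \<notin> U" "src b \<notin> U" "dst a \<in> U" "dst b \<in> U"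
    using intoD[OF assms(2)] by auto
  have c: "card (face_of G a) \<le> 6" "card (face_of G b) \<le> 6"
    using card_face[OF i(1)] card_face[OF i(2)] by auto
  obtain k where k: "0 < k" "k < card (face_of G a)" "(phi ^^ k) a = opp b"
    using assms(2) by (rule two_cut_exit)
  have into': "into U = {b, a}" using assms(2) by auto
  obtain l where l: "0 < l" "l < card (face_of G b)" "(phi ^^ l) b = opp a"
    using into' by (rule two_cut_exit)
  have fin: "finite U" "finite (V - U)" using finite_subset[OF assms(1) gr.finite_verts] by simp_all
  show False
  proof (cases "k + l \<le> 6")
    case True
    then show ?thesis using no_short_two_cut[OF fin(1) assms(2) k(3) l(3) k(1) l(1)] by simp
  next
    \<comment> \<open>Seen from the complement of \<open>U\<close>, the two faces have at most 12 -
      7 = 5 vertices, so the descent runs there.\<close>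
    case False
    have "x \<in> into (V - U) \<longleftrightarrow> x = opp b \<or> x = opp a" for x
    proof -
      have "x \<in> into (V - U) \<longleftrightarrow> opp x \<in> into U" by (auto simp: into_def)
      also have "\<dots> \<longleftrightarrow> opp x = b \<or> opp x = a" unfolding into' by simp
      also have "\<dots> \<longleftrightarrow> x = opp b \<or> x = opp a" by auto
      finally show ?thesis .
    qed
    then have into2: "into (V - U) = {opp b, opp a}" by blast
    have "(phi ^^ (card (face_of G a) - k)) (opp b) = (phi ^^ (card (face_of G a) - k + k)) a"
      unfolding k(3)[symmetric] funpow_add by simp
    also have "\<dots> = opp (opp a)" using k(2) funpow_card_face[OF i(1)] by simp
    finally have k': "(phi ^^ (card (face_of G a) - k)) (opp b) = opp (opp a)" .
    have "(phi ^^ (card (face_of G b) - l)) (opp a) = (phi ^^ (card (face_of G b) - l + l)) b"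
      unfolding l(3)[symmetric] funpow_add by simp
    also have "\<dots> = opp (opp b)" using l(2) funpow_card_face[OF i(2)] by simp
    finally have l': "(phi ^^ (card (face_of G b) - l)) (opp a) = opp (opp b)" .
    show ?thesis
      by (rule no_short_two_cut[OF fin(2) into2 k' l']) (use k(2) l(2) c False in linarith)+
  qed
qed

lemma faces_share_one_edge:
  assumes "a \<in> D" "b \<in> D" "face_of G a = face_of G b" "face_of G (opp a) = face_of G (opp b)"
  shows "a = b"
proof (rule ccontr)
  assume "a \<noteq> b"
  have "a \<noteq> opp b" using assms opp_notin_face[OF assms(2)] by (auto simp: face_eq_iff)
  then have ne: "edge_of G a \<noteq> edge_of G b" using \<open>a \<noteq> b\<close> by (simp add: edge_of_eq_iff)
  then have S: "sym_diff {edge_of G a} {edge_of G b} = {edge_of G a, edge_of G b}" by auto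
  \<comment> \<open>Both edges separate the same two faces, so their boundaries cancel modulo
    2.\<close>
  have "odd_faces (sym_diff {edge_of G a} {edge_of G b}) = {}"
    unfolding odd_faces_sym_diff odd_faces_edge[OF assms(1)] odd_faces_edge[OF assms(2)] assms(3,4) by blast
  then have "{edge_of G a, edge_of G b} \<in> even_sets"
    using assms(1,2) unfolding S even_sets_def by (auto simp: edges_def)
  then obtain U where U: "U \<subseteq> V" "{edge_of G a, edge_of G b} = edge_cut U" by (rule even_set_is_cut)
  have side: "\<exists>y \<in> into U. x = y \<or> x = opp y" if "x \<in> D" "edge_of G x \<in> edge_cut U" for x
  proof (cases "dst x \<in> U")
    case True
    then have "x \<in> into U" using that by (simp add: edge_in_cut_iff into_def)
    then show ?thesis by blast
  next
    case False
    then have "opp x \<in> into U" using that by (simp add: edge_in_cut_iff into_def)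
    then show ?thesis by (metis opp_opp)
  qed
  obtain c where c: "c \<in> into U" "a = c \<or> a = opp c" using side[OF assms(1)] U(2) by blast
  obtain d where d: "d \<in> into U" "b = d \<or> b = opp d" using side[OF assms(2)] U(2) by blast
  have "x = c \<or> x = d" if x: "x \<in> into U" for x
  proof -
    have "edge_of G x \<in> edge_cut U" using x by (auto simp: into_def edge_in_cut_iff)
    then have "edge_of G x = edge_of G c \<or> edge_of G x = edge_of G d"
      using c(2) d(2) U(2)[symmetric] by auto
    then show ?thesis using x c(1) d(1) by (auto simp: edge_of_eq_iff into_def)
  qed
  then have "into U = {c, d}" using c d by blast
  then show False using no_two_cut[OF U(1)] by blast
qed

end

section \<open>Clar structures\<close>

lemma orbit_4:
  assumes "f (f (f (f x))) = x" shows "orbit f x = {x, f x, f (f x), f (f (f x))}"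
proof -
  have "orbit f x = {(f ^^ m) x |m. m < 4}"
    by (rule orbit_altdef_bounded) (simp_all add: assms eval_nat_numeral)
  also have "\<dots> = (\<lambda>m. (f ^^ m) x) ` {..<4}" by auto
  also have "{..<4::nat} = {0, 1, 2, 3}" by auto
  finally show ?thesis by (simp add: eval_nat_numeral)
qed

text \<open>\<open>H_hexagon\<close> is the consequence of resonance on which the counting rests;
  \<open>alternating_hexagon\<close> supplies it.\<close>

locale clar_map = fullerene_map G for G :: "('v, 'd) embedded_graph" +
  fixes H M :: "'d set set"
  assumes H_faces: "H \<subseteq> faces G"
    and H_disjoint: "pairwise (\<lambda>f g. disjnt (face_verts G f) (face_verts G g)) H"
    and H_hexagon: "\<And>f. f \<in> H \<Longrightarrow> card f = 6"
    and M_matching: "perfect_matching_on G (vertices G - (\<Union>f \<in> H. face_verts G f)) M"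
begin

text \<open>\<open>PD\<close> is the set of darts of the parent. On it, \<open>nxt\<close> is the first return of \<open>phi\<close>, which
  rotates around a vertex of the parent, and \<open>psi\<close> walks around a face of the parent.\<close>

definition MD :: "'d set" where "MD = {a \<in> D. edge_of G a \<in> M}"
definition HD :: "'d set" where "HD = {a \<in> D. face_of G a \<in> H}"
definition PD :: "'d set" where "PD = {a \<in> D. a \<notin> MD \<and> a \<notin> HD \<and> opp a \<notin> HD}"

lemma MD_in: "a \<in> MD \<Longrightarrow> a \<in> D" and HD_in: "a \<in> HD \<Longrightarrow> a \<in> D" and PD_in: "a \<in> PD \<Longrightarrow> a \<in> D"
  by (simp_all add: MD_def HD_def PD_def)

lemma opp_MD [simp]: "opp a \<in> MD \<longleftrightarrow> a \<in> MD"
  by (simp add: MD_def)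

lemma phi_HD [simp]: "phi a \<in> HD \<longleftrightarrow> a \<in> HD"
  by (simp add: HD_def)

lemma phi_opp [simp]: "phi (opp a) = rot a"
  by (simp add: face_succ_def)

lemma opp_HD: "opp a \<in> HD \<longleftrightarrow> rot a \<in> HD"
  using phi_HD[of "opp a"] by simp

lemma face_rot: "face_of G (rot a) = face_of G (opp a)"
  using face_phi[of "opp a"] by simp

lemma face_opp_neq: "a \<in> D \<Longrightarrow> face_of G (opp a) \<noteq> face_of G a"
  using opp_notin_face[of a] by (simp add: face_eq_iff)

lemma finite_MD [simp]: "finite MD" and finite_HD [simp]: "finite HD" and finite_PD [simp]: "finite PD"
  by (simp_all add: MD_def HD_def PD_def)

lemma face_HD: "x \<in> HD \<Longrightarrow> y \<in> face_of G x \<Longrightarrow> y \<in> HD"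
  using face_subset[of x] by (auto simp: HD_def face_eq_iff)

lemma HD_unique:
  assumes "a \<in> HD" "b \<in> HD" "src b = src a" shows "b = a"
proof -
  have ab: "a \<in> D" "b \<in> D" "face_of G a \<in> H" "face_of G b \<in> H" using assms by (auto simp: HD_def)
  have "src a \<in> face_verts G (face_of G a)" "src a \<in> face_verts G (face_of G b)"
    unfolding face_verts_def using assms(3) by (metis self_in_face imageI)+
  then have "face_of G b = face_of G a" using H_disjoint ab unfolding pairwise_def disjnt_def by blast
  then show ?thesis using face_src_inj[OF ab(1)] assms(3) by (simp add: face_eq_iff)
qed

lemma matched_not_H:
  assumes "a \<in> MD" "b \<in> HD" "src b = src a" shows False
proof -
  have "src a \<in> ends G (edge_of G a)" by (simp add: ends_def edge_of_def)
  then have "src a \<notin> face_verts G (face_of G b)"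
    using assms M_matching unfolding perfect_matching_on_def MD_def HD_def by blast
  moreover have "src b \<in> face_verts G (face_of G b)"
    unfolding face_verts_def by (metis self_in_face imageI)
  ultimately show False using assms(3) by simp
qed

lemma matched_ex1:
  assumes "v \<in> vertices G - (\<Union>f \<in> H. face_verts G f)"
  shows "\<exists>!e. e \<in> M \<and> v \<in> ends G e"
  using M_matching assms unfolding perfect_matching_on_def by (elim conjE) (drule (1) bspec)

lemma MD_unique:
  assumes "a \<in> MD" "b \<in> MD" "src b = src a" shows "b = a"
proof -
  have ab: "a \<in> D" "b \<in> D" "edge_of G a \<in> M" "edge_of G b \<in> M" using assms by (auto simp: MD_def)
  have e: "src a \<in> ends G (edge_of G a)" "src a \<in> ends G (edge_of G b)"
    using assms(3) by (simp_all add: ends_def edge_of_def)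
  have "src a \<in> vertices G - (\<Union>f \<in> H. face_verts G f)"
    using ab(3) e(1) M_matching unfolding perfect_matching_on_def by blast
  from matched_ex1[OF this] have "edge_of G b = edge_of G a" using ab e by (elim ex1E) metis
  then have "b = a \<or> b = opp a" by (simp add: edge_of_eq_iff)
  then show ?thesis using assms(3) src_neq_dst[OF ab(1)] ab by auto
qed

lemma vertex_cases:
  assumes "v \<in> V"
  obtains (M) x where "x \<in> MD" "src x = v" | (H) x where "x \<in> HD" "src x = v"
proof (cases "\<exists>f \<in> H. v \<in> face_verts G f")
  case True
  then obtain f x where f: "f \<in> H" "x \<in> f" "src x = v" by (auto simp: face_verts_def)
  then have ff: "f \<in> faces G" using H_faces by blast
  have "x \<in> HD" using f face_of_mem[OF ff f(2)] mem_face_in[OF ff f(2)] by (simp add: HD_def)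
  then show ?thesis using H f by blast
next
  case False
  then have "v \<in> vertices G - (\<Union>f \<in> H. face_verts G f)" using assms by blast
  from matched_ex1[OF this] obtain e where e: "e \<in> M" "v \<in> ends G e" by (elim ex1E conjE)
  moreover have "M \<subseteq> edges G" using M_matching by (simp add: perfect_matching_on_def)
  ultimately obtain a where a: "a \<in> D" "e = edge_of G a" unfolding edges_def by blast
  then have m: "a \<in> MD" using e by (simp add: MD_def)
  have "v = src a \<or> v = src (opp a)" using e(2) a by (auto simp: ends_def edge_of_def)
  then show ?thesis
  proof
    assume "v = src a" then show ?thesis using M[OF m] by simp
  next
    assume "v = src (opp a)" then show ?thesis using M[of "opp a"] m by simp
  qed
qed

lemma PD_M:
  assumes "x \<in> MD" shows "rot x \<in> PD" "rot (rot x) \<in> PD"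
proof -
  have x: "x \<in> D" using assms by (rule MD_in)
  have m: "rot x \<notin> MD" "rot (rot x) \<notin> MD"
    using MD_unique[OF assms] x rot_neq[OF x] by (metis rot_in src_rot)+
  have h: "x \<notin> HD" "rot x \<notin> HD" "rot (rot x) \<notin> HD"
    using matched_not_H[OF assms] x by (metis rot_in src_rot)+
  show "rot x \<in> PD" "rot (rot x) \<in> PD" using x m h by (simp_all add: PD_def opp_HD)
qed

text \<open>At a vertex of a hexagon of \<open>H\<close>, the darts \<open>x\<close> and
  \<open>rot (rot x)\<close> run along the hexagon, forwards and backwards; \<open>rot x\<close> is
  the one that leaves it.\<close>

lemma PD_H:
  assumes "x \<in> HD" shows "rot x \<in> PD" "rot (rot x) \<notin> PD" "rot (rot x) \<notin> HD" "rot (rot x) \<notin> MD" "rot x \<notin> MD" "x \<notin> MD"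
proof -
  have x: "x \<in> D" using assms by (rule HD_in)
  show m: "rot x \<notin> MD" "rot (rot x) \<notin> MD" "x \<notin> MD"
    using matched_not_H[OF _ assms] x by (metis rot_in src_rot)+
  have h: "rot x \<notin> HD" "rot (rot x) \<notin> HD"
    using HD_unique[OF assms] x rot_neq[OF x] by (metis rot_in src_rot)+
  show "rot x \<in> PD" using x m h by (simp add: PD_def opp_HD)
  show "rot (rot x) \<notin> PD" using assms by (simp add: PD_def opp_HD)
  show "rot (rot x) \<notin> HD" by (rule h)
qed

lemma MD_not_PD: "x \<in> MD \<Longrightarrow> x \<notin> PD" and HD_not_PD: "x \<in> HD \<Longrightarrow> x \<notin> PD"
  by (simp_all add: PD_def)

lemma MD_not_HD: "x \<in> MD \<Longrightarrow> x \<notin> HD"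
  using matched_not_H by blast

lemma opp_PD [simp]: "opp a \<in> PD \<longleftrightarrow> a \<in> PD"
  by (auto simp: PD_def)

text \<open>Classification by the tail: a matched vertex emits two parent darts, a vertex of a
  hexagon of \<open>H\<close> only one.\<close>

lemma PD_cases:
  assumes "a \<in> PD"
  obtains (M1) x where "x \<in> MD" "a = rot x" | (M2) x where "x \<in> MD" "a = rot (rot x)"
    | (H) x where "x \<in> HD" "a = rot x"
proof -
  have a: "a \<in> D" using assms by (rule PD_in)
  then have "src a \<in> V" by simp
  then show ?thesis
  proof (cases rule: vertex_cases)
    case (M x)
    then have "a = x \<or> a = rot x \<or> a = rot (rot x)" using same_src[of x a] a MD_in by simp
    then show ?thesis using M assms M1 M2 MD_not_PD by blast
  next
    case (H x)
    then have "a = x \<or> a = rot x \<or> a = rot (rot x)" using same_src[of x a] a HD_in by simp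
    then show ?thesis using H assms HD_not_PD PD_H(2) that(3) by blast
  qed
qed

text \<open>If the edge of \<open>a\<close> is matched or borders a hexagon of \<open>H\<close> on
  the other side, the vertex it leads to has used up its special dart, and the next edge of the face
  survives. So a first return to \<open>PD\<close> skips at most one dart.\<close>

lemma phi_PD:
  assumes "a \<in> D" "a \<notin> HD" "a \<notin> PD" shows "phi a \<in> PD"
proof -
  have "a \<in> MD \<or> opp a \<in> HD" using assms by (auto simp: PD_def)
  then have "rot (opp a) \<in> PD" using PD_M(1)[of "opp a"] PD_H(1)[of "opp a"] by auto
  then show ?thesis by (simp add: face_succ_def)
qed

section \<open>Rotation and face walks of the parent, on darts of the fullerene\<close>

definition nxt :: "'d \<Rightarrow> 'd" where
  "nxt a = (if phi a \<in> PD then phi a else phi (phi a))"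

lemma nxt_PD: assumes "a \<in> PD" shows "nxt a \<in> PD"
proof -
  have "a \<in> D" "a \<notin> HD" using assms by (auto simp: PD_def)
  then show ?thesis using phi_PD[of "phi a"] by (simp add: nxt_def)
qed

lemma face_nxt [simp]: "face_of G (nxt a) = face_of G a"
  by (simp add: nxt_def)

lemma nxt_inj: "inj_on nxt PD"
  by (rule inj_onI) (auto simp: nxt_def phi_inj split: if_splits)

lemma face_inter_PD_nxt:
  assumes "a \<in> PD" shows "orbit nxt a = face_of G a \<inter> PD"
proof
  have "b \<in> face_of G a \<inter> PD" if "b \<in> orbit nxt a" for b
    using that
  proof induction
    case base then show ?case using assms nxt_PD by (simp add: face_eq_iff)
  next
    case (step y) then show ?case using nxt_PD by (simp add: face_eq_iff)
  qed
  then show "orbit nxt a \<subseteq> face_of G a \<inter> PD" by blast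
  have aD: "a \<in> D" "a \<notin> HD" using assms by (auto simp: PD_def)
  \<comment> \<open>Induction along the fullerene face; at a skipped dart the claim is shifted to
    its successor, which is never skipped.\<close>
  have *: "(b \<in> PD \<longrightarrow> b \<in> orbit nxt a) \<and> (b \<notin> PD \<longrightarrow> phi b \<in> orbit nxt a)"
    if "b \<in> orbit phi a" for b
    using that
  proof induction
    case base
    have "nxt a \<in> orbit nxt a" by (rule orbit.base)
    then show ?case by (auto simp: nxt_def[of a] split: if_splits)
  next
    case (step y)
    have y: "y \<in> D" "y \<notin> HD" using step.hyps aD face_eq_iff[of y a] face_subset[OF aD(1)]
      by (auto simp: face_of_def HD_def)
    show ?case
    proof (cases "y \<in> PD")
      case True
      then have "nxt y \<in> orbit nxt a" using step.IH by (auto intro: orbit.step)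
      then show ?thesis by (auto simp: nxt_def[of y] split: if_splits)
    next
      case False
      then show ?thesis using step.IH phi_PD[OF y] by simp
    qed
  qed
  show "face_of G a \<inter> PD \<subseteq> orbit nxt a"
    using * by (auto simp: face_of_def)
qed

text \<open>\<open>phi\<close> maps the skipped darts of the face injectively to surviving ones, so
  at least half survive: three of a pentagon or of a hexagon.\<close>

lemma card_face_inter_PD:
  assumes "a \<in> D" "a \<notin> HD"
  shows "card (face_of G a) \<le> 2 * card (face_of G a \<inter> PD)" "3 \<le> card (face_of G a \<inter> PD)"
proof -
  let ?f = "face_of G a"
  have fin: "finite ?f" using assms(1) face_in_faces by simp
  have "phi ` (?f - PD) \<subseteq> ?f \<inter> PD"
  proof (clarify)
    fix b assume b: "b \<in> ?f" "b \<notin> PD"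
    have "b \<in> D" "b \<notin> HD" using b(1) assms face_subset[OF assms(1)] by (auto simp: face_eq_iff HD_def)
    then show "phi b \<in> ?f \<inter> PD" using phi_PD b by simp
  qed
  then have "card (?f - PD) \<le> card (?f \<inter> PD)"
    using fin by (metis card_image card_mono finite_Int inj_onI phi_inj)
  moreover have "card ?f = card (?f \<inter> PD) + card (?f - PD)" using fin by (rule card_Int_Diff)
  ultimately show "card ?f \<le> 2 * card (?f \<inter> PD)" by simp
  then show "3 \<le> card (?f \<inter> PD)" using card_face[OF assms(1)] by auto
qed

definition psi :: "'d \<Rightarrow> 'd" where "psi a = nxt (opp a)"

text \<open>In the dual, each vertex of the fullerene is a triangle. Deleting the dual edge that
  crosses a matched edge merges two triangles into a quadrilateral, and these are two of the four
  steps around it.\<close>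

lemma psi_M: assumes "x \<in> MD" shows "psi (rot x) = rot (rot x)" "psi (rot (rot x)) = rot (opp x)"
  using PD_M[OF assms] MD_not_PD[OF assms] by (simp_all add: psi_def nxt_def, simp add: face_succ_def)

lemma psi_orbit_M: assumes "x \<in> MD"
  shows "orbit psi (rot x) = {rot x, rot (rot x), rot (opp x), rot (rot (opp x))}"
    "orbit psi (rot (rot x)) = {rot x, rot (rot x), rot (opp x), rot (rot (opp x))}"
proof -
  have x: "opp x \<in> MD" using assms by simp
  note p = psi_M[OF assms] psi_M[OF x, unfolded opp_opp]
  have *: "orbit psi (rot x) = {rot x, rot (rot x), rot (opp x), rot (rot (opp x))}"
    using orbit_4[of psi "rot x"] by (simp add: p)
  then show "orbit psi (rot x) = {rot x, rot (rot x), rot (opp x), rot (rot (opp x))}" .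
  have "rot x \<in> orbit psi (rot x)" unfolding * by simp
  then have "orbit psi (psi (rot x)) = orbit psi (rot x)" by (rule self_in_orbit_step)
  then show "orbit psi (rot (rot x)) = {rot x, rot (rot x), rot (opp x), rot (rot (opp x))}" using * p by simp
qed

text \<open>The parent face around a hexagon of \<open>H\<close> is walked against the direction of
  \<open>phi\<close>, hence \<open>inv phi\<close> in the next proof.\<close>

lemma psi_H: assumes "phi y \<in> HD" shows "psi (rot (phi y)) = rot y"
proof -
  have "rot (rot (phi y)) = opp y" by (simp add: face_succ_def)
  then show ?thesis using PD_H(2)[OF assms] by (simp add: psi_def nxt_def)
qed

lemma psi_orbit_H: assumes "x \<in> HD"
  shows "orbit psi (rot x) = rot ` face_of G x"
proof -
  note m = face_HD[OF assms]
  have inv: "inv phi (phi y) = y" for y by (simp add: inv_f_f inj_def phi_inj)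
  have o: "orbit (inv phi) x = face_of G x"
    unfolding face_of_def by (rule orbit_inv_eq[OF phi_permutation])
  have "rot ` orbit (inv phi) x = orbit psi (rot x)"
  proof (rule orbit_inverse)
    show "x \<in> orbit (inv phi) x" unfolding o by simp
    fix z assume "z \<in> orbit (inv phi) x"
    then have z: "z \<in> HD" using o m by simp
    obtain y where y: "z = phi y" using phi_permutes by (metis permutes_surj surjD)
    then show "psi (rot z) = rot (inv phi z)" using psi_H z by (simp add: inv)
  qed
  then show ?thesis unfolding o by simp
qed

text \<open>Faces that meet along an edge differ by \<open>face_opp_neq\<close>. The critical pair
  is \<open>E\<close>, the faces at the two ends of \<open>x\<close>: if they were equal, that face
  would share two edges with one beside \<open>x\<close>, and \<open>faces_share_one_edge\<close>
  would make \<open>x\<close> and \<open>rot x\<close> parallel.\<close>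

lemma face_inj_quad:
  assumes "x \<in> MD"
  shows "inj_on (face_of G) {rot x, rot (rot x), rot (opp x), rot (rot (opp x))}"
    "card {rot x, rot (rot x), rot (opp x), rot (rot (opp x))} = 4"
proof -
  have x: "x \<in> D" using assms by (rule MD_in)
  have A: "face_of G (rot a) \<noteq> face_of G (rot (rot a))" if "a \<in> D" for a
    using face_rot[of "rot a"] face_opp_neq[of "rot a"] that by simp
  have B: "face_of G (rot x) \<noteq> face_of G (rot (opp x))"
    using face_rot[of x] face_rot[of "opp x"] face_opp_neq[of x] x by simp
  have C: "face_of G (rot a) \<noteq> face_of G (rot (rot (opp a)))" if "a \<in> D" for a
    using face_rot[of a] face_rot[of "rot (rot (opp a))"] face_opp_neq[of "rot (rot (opp a))"] that by simp
  have E: "face_of G (rot (rot x)) \<noteq> face_of G (rot (rot (opp x)))"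
  proof
    assume e: "face_of G (rot (rot x)) = face_of G (rot (rot (opp x)))"
    have "rot (rot (opp x)) = opp (rot x)"
    proof (rule faces_share_one_edge)
      show "face_of G (rot (rot (opp x))) = face_of G (opp (rot x))"
        using e face_rot[of "rot x"] by simp
      show "face_of G (opp (rot (rot (opp x)))) = face_of G (opp (opp (rot x)))"
        using face_rot[of "rot (rot (opp x))"] face_rot[of x] by simp
    qed (use x in simp_all)
    then have "src (rot (rot (opp x))) = dst (rot x)" using x by simp
    then have "dst (rot x) = dst x" using x by simp
    then have "rot x = x" using no_multi[of "rot x" x] x by simp
    then show False using rot_neq x by blast
  qed
  show inj: "inj_on (face_of G) {rot x, rot (rot x), rot (opp x), rot (rot (opp x))}"
    using A[OF x] A[of "opp x"] B C[OF x] C[of "opp x"] E x by (auto simp: inj_on_def)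
  have "face_of G ` {rot x, rot (rot x), rot (opp x), rot (rot (opp x))} =
      {face_of G (rot x), face_of G (rot (rot x)), face_of G (rot (opp x)), face_of G (rot (rot (opp x)))}" by simp
  moreover have "card \<dots> = 4" using A[OF x] A[of "opp x"] B C[OF x] C[of "opp x"] E x by (simp add: card_insert_if)
  ultimately show "card {rot x, rot (rot x), rot (opp x), rot (rot (opp x))} = 4"
    using card_image[OF inj] by metis
qed

lemma face_inj_hexagon:
  assumes "x \<in> HD"
  shows "inj_on (face_of G) (rot ` face_of G x)" "card (rot ` face_of G x) = 6"
proof -
  have x: "x \<in> D" "face_of G x \<in> H" using assms by (auto simp: HD_def)
  show "inj_on (face_of G) (rot ` face_of G x)"
  proof (rule inj_onI, clarify)
    fix y z assume yz: "y \<in> face_of G x" "z \<in> face_of G x" "face_of G (rot y) = face_of G (rot z)"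
    have "y = z"
      by (rule faces_share_one_edge) (use yz face_subset[OF x(1)] in \<open>auto simp: face_rot face_eq_iff\<close>)
    then show "rot y = rot z" by simp
  qed
  show "card (rot ` face_of G x) = 6" using H_hexagon[OF x(2)] by (simp add: card_image inj_on_def rot_inj)
qed

section \<open>Counting vertices, darts and faces\<close>

lemma card_V: "card V = card HD + card MD"
proof -
  have "card (HD \<union> MD) = card HD + card MD"
    by (rule card_Un_disjoint) (use MD_not_HD in auto)
  \<comment> \<open>Every vertex emits exactly one dart that is matched or lies on a face of
    \<open>H\<close>.\<close>
  moreover have "bij_betw src (HD \<union> MD) V"
  proof (rule bij_betw_imageI)
    show "inj_on src (HD \<union> MD)"
      by (rule inj_onI) (metis HD_unique MD_unique UnE matched_not_H)
    show "src ` (HD \<union> MD) = V"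
    proof
      show "src ` (HD \<union> MD) \<subseteq> V" using HD_in MD_in by auto
      show "V \<subseteq> src ` (HD \<union> MD)"
      proof
        fix v assume "v \<in> V"
        then show "v \<in> src ` (HD \<union> MD)" by (cases rule: vertex_cases) blast+
      qed
    qed
  qed
  ultimately show ?thesis by (simp add: bij_betw_same_card)
qed

lemma finite_H [simp]: "finite H"
  by (rule finite_subset[OF H_faces finite_faces])

lemma card_HD: "card HD = 6 * card H"
proof -
  have U: "\<Union> H = HD"
    using H_faces face_of_mem mem_face_in self_in_face unfolding HD_def by blast
  have "6 * card H = card (\<Union> H)"
  proof (rule card_partition)
    show "finite (\<Union> H)" unfolding U by simp
    show "c1 \<inter> c2 = {}" if "c1 \<in> H" "c2 \<in> H" "c1 \<noteq> c2" for c1 c2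
      using that H_faces face_of_mem by blast
  qed (simp_all add: H_hexagon)
  then show ?thesis using U by simp
qed

text \<open>One parent dart leaves each vertex on \<open>H\<close> and two leave each matched
  vertex.\<close>

lemma card_PD: "card PD = card HD + 2 * card MD"
proof -
  have e: "PD = rot ` HD \<union> (rot ` MD \<union> (\<lambda>x. rot (rot x)) ` MD)"
    using PD_M PD_H(1) by (auto elim: PD_cases)
  have i: "inj_on rot S" "inj_on (\<lambda>x. rot (rot x)) S" for S by (simp_all add: inj_on_def rot_inj)
  have "rot ` MD \<inter> (\<lambda>x. rot (rot x)) ` MD = {}"
    using PD_M(1) MD_not_PD by (auto simp: rot_inj) blast
  then have 1: "card (rot ` MD \<union> (\<lambda>x. rot (rot x)) ` MD) = 2 * card MD"
    by (simp add: card_Un_disjoint card_image[OF i(1)] card_image[OF i(2)])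
  have "rot ` HD \<inter> (rot ` MD \<union> (\<lambda>x. rot (rot x)) ` MD) = {}"
    using MD_not_HD PD_M(1) HD_not_PD by (auto simp: rot_inj) blast
  then show ?thesis
    unfolding e using 1 by (simp add: card_Un_disjoint card_image[OF i(1)])
qed

lemma card_D: "card D = 3 * card V"
proof -
  have "D = (\<Union>v\<in>V. out_arcs (graph_of G) v)" by auto
  moreover have "card (\<Union>v\<in>V. out_arcs (graph_of G) v) = (\<Sum>v\<in>V. card (out_arcs (graph_of G) v))"
    by (rule card_UN_disjoint) (auto simp: out_arcs_def)
  ultimately have "card D = (\<Sum>v\<in>V. card (out_arcs (graph_of G) v))" by simp
  then show ?thesis using card_out_arcs by simp
qed

lemma faces_PD: "face_of G ` PD = faces G - H"
proof
  show "face_of G ` PD \<subseteq> faces G - H" by (auto simp: PD_def HD_def faces_def)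
  show "faces G - H \<subseteq> face_of G ` PD"
  proof
    fix f assume "f \<in> faces G - H"
    then obtain a where a: "a \<in> D" "f = face_of G a" "a \<notin> HD" by (auto simp: faces_def HD_def)
    show "f \<in> face_of G ` PD"
    proof (cases "a \<in> PD")
      case False
      then have "phi a \<in> PD" using phi_PD a by simp
      then show ?thesis using a(2) by (intro image_eqI[of _ _ "phi a"]) simp_all
    qed (use a in simp)
  qed
qed

text \<open>The darts of the parent at a vertex of the fullerene all lie on one orbit of \<open>psi\<close>, and adjacent
  vertices are linked by a dart or by such an orbit.\<close>

lemma PD_connected:
  assumes "T \<subseteq> PD" "T \<noteq> {}" and o: "\<And>a. a \<in> T \<Longrightarrow> opp a \<in> T" and n: "\<And>a. a \<in> T \<Longrightarrow> nxt a \<in> T"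
  shows "T = PD"
proof -
  have psi: "b \<in> T" if "a \<in> T" "b \<in> orbit psi a" for a b
    using that(2,1)
  proof induction
    case base then show ?case unfolding psi_def using n o by simp
  next
    case (step y) then show ?case unfolding psi_def using n o by simp
  qed
  define W where "W = src ` T"
  have W: "a \<in> T" if a: "a \<in> PD" "src a \<in> W" for a
  proof -
    obtain t where t: "t \<in> T" "src t = src a" using a(2) unfolding W_def by (metis imageE)
    have tP: "t \<in> PD" using t(1) assms(1) by blast
    have ta: "t \<in> D" "a \<in> D" using tP a(1) PD_in by simp_all
    show ?thesis using a(1)
    proof (cases rule: PD_cases)
      case (M1 x)
      then have "t = x \<or> t = rot x \<or> t = rot (rot x)" using same_src[of x t] t ta MD_in[of x] by simp
      then have "t = rot x \<or> t = rot (rot x)" using MD_not_PD M1 tP by blast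
      then show ?thesis using psi[OF t(1)] psi_orbit_M[OF M1(1)] M1(2) by auto
    next
      case (M2 x)
      then have "t = x \<or> t = rot x \<or> t = rot (rot x)" using same_src[of x t] t ta MD_in[of x] by simp
      then have "t = rot x \<or> t = rot (rot x)" using MD_not_PD M2 tP by blast
      then show ?thesis using psi[OF t(1)] psi_orbit_M[OF M2(1)] M2(2) by auto
    next
      case (H x)
      then have "t = x \<or> t = rot x \<or> t = rot (rot x)" using same_src[of x t] t ta HD_in[of x] by simp
      then have "t = rot x" using HD_not_PD PD_H(2) H tP by blast
      then show ?thesis using t(1) H(2) by simp
    qed
  qed
  have "W = V"
  proof (rule vertex_connected)
    show "W \<subseteq> V" unfolding W_def using assms(1) PD_in gr.tail_in_verts by blast
    show "W \<noteq> {}" using assms(2) by (simp add: W_def)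
    fix d assume d: "d \<in> D" "src d \<in> W"
    consider "d \<in> PD" | "d \<in> MD" | "d \<in> HD" | "opp d \<in> HD" using d(1) by (auto simp: PD_def)
    then show "dst d \<in> W"
    proof cases
      case 1
      then have "opp d \<in> T" using W d o by blast
      then have "src (opp d) \<in> W" unfolding W_def by (rule imageI)
      then show ?thesis using d by simp
    next
      case 2
      then have "rot d \<in> T" using W[of "rot d"] d PD_M(1) by simp
      then have "rot (opp d) \<in> T" by (rule psi) (simp add: psi_orbit_M[OF 2])
      then have "src (rot (opp d)) \<in> W" unfolding W_def by (rule imageI)
      then show ?thesis using d by simp
    next
      case 3
      then have "rot d \<in> T" using W[of "rot d"] d PD_H(1) by simp
      then have "rot (phi d) \<in> T" by (rule psi) (simp add: psi_orbit_H[OF 3])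
      then have "src (rot (phi d)) \<in> W" unfolding W_def by (rule imageI)
      then show ?thesis using d by simp
    next
      case 4
      have rd: "rot d \<in> HD" using 4 by (simp add: opp_HD)
      then have "rot (rot d) \<in> T" using W[of "rot (rot d)"] d PD_H(1)[OF rd] by simp
      then have "rot (opp d) \<in> T"
        by (rule psi) (simp add: psi_orbit_H[OF rd] face_eq_iff face_rot)
      then have "src (rot (opp d)) \<in> W" unfolding W_def by (rule imageI)
      then show ?thesis using d by simp
    qed
  qed
  then show ?thesis using W assms(1) PD_in gr.tail_in_verts by blast
qed

end

section \<open>The expansion and its parent\<close>

lemma orbit_eq_iff: "permutation f \<Longrightarrow> y \<in> orbit f x \<longleftrightarrow> orbit f y = orbit f x"
  using orbit_cyclic_eq3[OF cyclic_on_orbit'] permutation_self_in_orbit by metis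

context clar_map
begin

abbreviation "ED \<equiv> exp_darts G M"
abbreviation "erev \<equiv> exp_rev G"
abbreviation "esucc \<equiv> exp_succ G M"
abbreviation "E \<equiv> expansion G M"
abbreviation "ephi \<equiv> face_succ E"
abbreviation "eface \<equiv> face_of E"
abbreviation "cells \<equiv> kept_faces H \<union> new_quads G M"

lemma ED_iff [simp]:
  "Keep a \<in> ED \<longleftrightarrow> a \<in> D \<and> a \<notin> MD"
  "SideL a \<in> ED \<longleftrightarrow> a \<in> MD" "SideR a \<in> ED \<longleftrightarrow> a \<in> MD"
  "EndL a \<in> ED \<longleftrightarrow> a \<in> MD" "EndR a \<in> ED \<longleftrightarrow> a \<in> MD"
  by (auto simp: exp_darts_def MD_def)

lemma finite_ED: "finite ED"
  by (simp add: exp_darts_def)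

lemma in_M_iff: "a \<in> D \<Longrightarrow> edge_of G a \<in> M \<longleftrightarrow> a \<in> MD"
  by (simp add: MD_def)

lemma erev_in: "x \<in> ED \<Longrightarrow> erev x \<in> ED"
  by (cases x) simp_all

lemma erev_erev: "erev (erev x) = x"
  by (cases x) simp_all

lemma esucc_Keep: "a \<in> D \<Longrightarrow> esucc (Keep a) =
    (if rot a \<in> MD then SideR (rot a) else if rot (rot a) \<in> MD then EndL (rot (rot a)) else Keep (rot a))"
  by (simp add: Let_def in_M_iff)

lemma rot_MD: "a \<in> MD \<Longrightarrow> rot a \<notin> MD" "a \<in> MD \<Longrightarrow> rot (rot a) \<notin> MD"
  using PD_M MD_not_PD by blast+

lemma esucc_in: "x \<in> ED \<Longrightarrow> esucc x \<in> ED"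
  by (cases x) (auto simp: esucc_Keep rot_MD MD_in simp del: exp_succ.simps(1))

lemma esucc_esucc_esucc: "x \<in> ED \<Longrightarrow> esucc (esucc (esucc x)) = x"
  by (cases x) (auto simp: esucc_Keep rot_MD MD_in simp del: exp_succ.simps(1))

lemma E_simps [simp]:
  "darts E = ED" "edge_rev E = perm_restrict erev ED" "edge_succ E = perm_restrict esucc ED"
  by (simp_all add: expansion_def Let_def)

lemma ephi_eq: "x \<in> ED \<Longrightarrow> ephi x = esucc (erev x)"
  by (simp add: face_succ_def perm_restrict_simps erev_in)

lemma ephi_Keep: "a \<in> D \<Longrightarrow> a \<notin> MD \<Longrightarrow> ephi (Keep a) =
    (if phi a \<in> MD then SideR (phi a) else if rot (phi a) \<in> MD then EndL (rot (phi a)) else Keep (phi a))"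
  by (simp add: ephi_eq esucc_Keep face_succ_def[of G] del: exp_succ.simps(1))

lemma ephi_Side_End:
  "a \<in> MD \<Longrightarrow> ephi (SideL a) = EndR (opp a)" "a \<in> MD \<Longrightarrow> ephi (EndR a) = SideL a"
  "a \<in> MD \<Longrightarrow> ephi (SideR a) = Keep (phi a)" "a \<in> MD \<Longrightarrow> ephi (EndL a) = Keep (rot (rot a))"
  by (simp_all add: ephi_eq face_succ_def[of G])

lemma ephi_permutes: "ephi permutes ED"
proof (rule bij_imp_permutes)
  show "bij_betw ephi ED ED"
    \<comment> \<open>The expansion is cubic, so applying \<open>esucc\<close> twice inverts
      it.\<close>
    by (rule bij_betw_byWitness[of _ "\<lambda>x. erev (esucc (esucc x))"])
      (auto simp: ephi_eq esucc_esucc_esucc erev_erev erev_in esucc_in)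
  show "ephi x = x" if "x \<notin> ED" for x
    using that by (simp add: face_succ_def perm_restrict_simps)
qed

lemma ephi_permutation: "permutation ephi"
  using ephi_permutes finite_ED by (metis permutation_permutes)

lemma eface_self: "x \<in> eface x"
  unfolding face_of_def by (rule permutation_self_in_orbit[OF ephi_permutation])

lemma eface_ephi: "eface (ephi x) = eface x"
  unfolding face_of_def by (rule permutation_orbit_step[OF ephi_permutation])

lemma eface_quad: assumes "a \<in> MD" shows "eface (SideL a) \<in> new_quads G M"
proof -
  have "eface (SideL a) = {SideL a, EndR (opp a), SideL (opp a), EndR a}"
    unfolding face_of_def using assms by (subst orbit_4) (simp_all add: ephi_Side_End)
  then show ?thesis using assms by (auto simp: new_quads_def MD_def)
qed

lemma eface_kept: assumes "a \<in> HD" shows "eface (Keep a) \<in> kept_faces H"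
proof -
  have a: "a \<in> D" "face_of G a \<in> H" using assms by (auto simp: HD_def)
  have "Keep ` orbit phi a = orbit ephi (Keep a)"
  proof (rule orbit_inverse)
    show "a \<in> orbit phi a" using self_in_face by (simp add: face_of_def)
    fix x assume "x \<in> orbit phi a"
    then have "x \<in> face_of G a" by (simp add: face_of_def)
    then have x: "x \<in> HD" by (rule face_HD[OF assms])
    then have "phi x \<in> HD" by simp
    then show "ephi (Keep x) = Keep (phi x)"
      using PD_H(5,6)[of "phi x"] PD_H(6)[OF x] x HD_in by (simp add: ephi_Keep)
  qed
  then show ?thesis using a unfolding kept_faces_def face_of_def by blast
qed

text \<open>The constructor tells the kind of face: a new quadrilateral is bordered by
  \<open>SideL\<close> and \<open>EndR\<close> darts only, whereas \<open>SideR\<close> and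
  \<open>EndL\<close> darts border enlarged old faces.\<close>

lemma eface_cells:
  assumes "x \<in> ED"
  shows "eface x \<in> cells \<longleftrightarrow> (\<exists>a. x = SideL a \<or> x = EndR a \<or> x = Keep a \<and> a \<in> HD)"
proof
  assume "eface x \<in> cells"
  then show "\<exists>a. x = SideL a \<or> x = EndR a \<or> x = Keep a \<and> a \<in> HD"
  proof
    assume "eface x \<in> kept_faces H"
    then obtain f where f: "f \<in> H" "eface x = Keep ` f" by (auto simp: kept_faces_def)
    then obtain a where a: "a \<in> f" "x = Keep a" using eface_self[of x] by blast
    have "f \<in> faces G" using f H_faces by blast
    then have "a \<in> HD" using a f face_of_mem mem_face_in by (simp add: HD_def)
    then show ?thesis using a by blast
  next
    assume "eface x \<in> new_quads G M"
    then show ?thesis using eface_self[of x] by (auto simp: new_quads_def)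
  qed
next
  assume "\<exists>a. x = SideL a \<or> x = EndR a \<or> x = Keep a \<and> a \<in> HD"
  then obtain a where "x = SideL a \<or> x = EndR a \<or> x = Keep a \<and> a \<in> HD" by blast
  then consider "x = SideL a" | "x = EndR a" | "x = Keep a" "a \<in> HD" by blast
  then show "eface x \<in> cells"
  proof cases
    case 1 then show ?thesis using eface_quad assms by simp
  next
    case 2
    then have "a \<in> MD" using assms by simp
    then show ?thesis using eface_quad[of a] eface_ephi[of "EndR a"] 2 by (simp add: ephi_Side_End)
  next
    case 3 then show ?thesis using eface_kept by simp
  qed
qed

section \<open>Faces of the expansion compared with faces of the fullerene\<close>

definition lift :: "'d \<Rightarrow> 'd exp_dart" where
  "lift a = (if a \<in> MD then SideR a else Keep a)"

lemma lift_in: "a \<in> D \<Longrightarrow> lift a \<in> ED"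
  by (simp add: lift_def)

text \<open>Faces lie to the right of their darts, so of the two copies of a matched
  \<open>a\<close> it is \<open>SideR a\<close> that borders the old face. One fullerene step is one
  expansion step, except where a split vertex inserts an \<open>EndL\<close> dart.\<close>

lemma eface_lift_phi: assumes "a \<in> D" shows "eface (lift (phi a)) = eface (lift a)"
proof -
  consider "a \<in> MD" | "a \<notin> MD" "phi a \<in> MD" | "a \<notin> MD" "phi a \<notin> MD" "rot (phi a) \<in> MD"
    | "a \<notin> MD" "phi a \<notin> MD" "rot (phi a) \<notin> MD" by blast
  then show ?thesis
  proof cases
    case 1
    then have "phi a \<notin> MD" using rot_MD(1)[of "opp a"] by (simp add: face_succ_def)
    then show ?thesis using 1 eface_ephi[of "SideR a"] by (simp add: lift_def ephi_Side_End)
  next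
    case 2
    then show ?thesis using assms eface_ephi[of "Keep a"] by (simp add: lift_def ephi_Keep)
  next
    case 3
    then show ?thesis using assms eface_ephi[of "Keep a"] eface_ephi[of "EndL (rot (phi a))"]
      by (simp add: lift_def ephi_Keep ephi_Side_End)
  next
    case 4
    then show ?thesis using assms eface_ephi[of "Keep a"] by (simp add: lift_def ephi_Keep)
  qed
qed

text \<open>The face of \<open>G\<close> below a face of the expansion; empty for new quadrilaterals.\<close>

primrec under :: "'d exp_dart \<Rightarrow> 'd set" where
  "under (Keep a) = face_of G a"
| "under (SideR a) = face_of G a"
| "under (EndL a) = face_of G (rot (rot a))"
| "under (SideL a) = {}"
| "under (EndR a) = {}"

lemma under_ephi: "x \<in> ED \<Longrightarrow> under (ephi x) = under x"
  by (cases x) (auto simp: ephi_Keep ephi_Side_End)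

lemma under_eface: assumes "x \<in> ED" "y \<in> eface x" shows "under y = under x"
proof -
  have "y \<in> orbit ephi x" using assms(2) by (simp add: face_of_def)
  then have "y \<in> ED \<and> under y = under x"
  proof induction
    case base then show ?case using assms(1) under_ephi ephi_permutes by (simp add: permutes_in_image)
  next
    case (step z) then show ?case using under_ephi ephi_permutes by (simp add: permutes_in_image)
  qed
  then show ?thesis by simp
qed

lemma under_lift: "under (lift a) = face_of G a"
  by (simp add: lift_def)

text \<open>\<open>under\<close> is constant along expansion faces and so keeps lifts of different
  faces apart; conversely \<open>lift\<close> carries a walk around a face into a single expansion
  face.\<close>

lemma eface_lift_iff:
  assumes "a \<in> D" "b \<in> D"
  shows "eface (lift a) = eface (lift b) \<longleftrightarrow> face_of G a = face_of G b"
proof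
  assume "eface (lift a) = eface (lift b)"
  then show "face_of G a = face_of G b"
    using under_eface[OF lift_in[OF assms(1)], of "lift b"] eface_self[of "lift b"] by (simp add: under_lift)
next
  assume "face_of G a = face_of G b"
  then have "a \<in> orbit phi b" using self_in_face[of a] by (simp add: face_of_def)
  then have "a \<in> D \<and> eface (lift a) = eface (lift b)"
    by induction (use assms eface_lift_phi in simp_all)
  then show "eface (lift a) = eface (lift b)" ..
qed

lemma lift_PD: "a \<in> PD \<Longrightarrow> lift a = Keep a"
  using MD_not_PD by (auto simp: lift_def)

lemma eface_PD_iff: "a \<in> PD \<Longrightarrow> b \<in> PD \<Longrightarrow> eface (Keep a) = eface (Keep b) \<longleftrightarrow> face_of G a = face_of G b"
  using eface_lift_iff[of a b] PD_in by (simp add: lift_PD)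

section \<open>Vertices, darts and rotation of the parent\<close>

abbreviation "P \<equiv> parent G H M"

lemma verts_P: "vertices P = (\<lambda>a. eface (Keep a)) ` PD"
proof
  have V: "vertices P = faces E - cells" by (simp add: parent_def inverse_leapfrog_def Let_def)
  have "eface (lift a) \<in> (\<lambda>a. eface (Keep a)) ` PD" if a: "a \<in> D" "a \<notin> HD" for a
  proof (cases "a \<in> PD")
    case True
    then show ?thesis by (simp add: lift_PD)
  next
    case False
    then have p: "phi a \<in> PD" using phi_PD a by simp
    then have "eface (lift a) = eface (Keep (phi a))" using eface_lift_phi[OF a(1)] by (simp add: lift_PD)
    then show ?thesis using p by blast
  qed
  note * = this
  show "vertices P \<subseteq> (\<lambda>a. eface (Keep a)) ` PD"
  proof
    fix v assume v: "v \<in> vertices P"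
    then obtain x where x: "x \<in> ED" "v = eface x" by (auto simp: V faces_def)
    have n: "\<nexists>a. x = SideL a \<or> x = EndR a \<or> x = Keep a \<and> a \<in> HD"
      using v eface_cells[OF x(1)] x(2) by (simp add: V)
    show "v \<in> (\<lambda>a. eface (Keep a)) ` PD"
    proof (cases x)
      case (Keep a)
      then show ?thesis using x n *[of a] by (simp add: lift_def)
    next
      case (SideR a)
      then show ?thesis using x n *[of a] MD_in MD_not_HD by (simp add: lift_def)
    next
      case (EndL a)
      then have m: "a \<in> MD" using x by simp
      then have "rot (rot a) \<notin> HD" using HD_not_PD PD_M(2) by blast
      then show ?thesis using x EndL m *[of "rot (rot a)"] MD_in rot_MD(2)[OF m] eface_ephi[of x]
        by (simp add: lift_def ephi_Side_End)
    qed (use n in auto)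
  qed
  show "(\<lambda>a. eface (Keep a)) ` PD \<subseteq> vertices P"
  proof (rule image_subsetI)
    fix a assume a: "a \<in> PD"
    then have "Keep a \<in> ED" "a \<notin> HD" using MD_not_PD by (auto simp: PD_def)
    then show "eface (Keep a) \<in> vertices P" using eface_cells[of "Keep a"] by (simp add: V faces_def)
  qed
qed

lemma darts_P: "darts P = Keep ` PD"
proof -
  have "darts P = {x \<in> ED. eface x \<in> faces E - cells \<and> eface (edge_rev E x) \<in> faces E - cells}"
    by (simp add: parent_def inverse_leapfrog_def Let_def)
  also have "\<dots> = {x \<in> ED. eface x \<notin> cells \<and> eface (erev x) \<notin> cells}"
    using erev_in by (auto simp: faces_def perm_restrict_simps)
  also have "\<dots> = Keep ` PD"
  proof (rule set_eqI)
    fix x :: "'d exp_dart"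
    have "x \<in> {x \<in> ED. eface x \<notin> cells \<and> eface (erev x) \<notin> cells} \<longleftrightarrow>
      x \<in> ED \<and> (\<nexists>a. x = SideL a \<or> x = EndR a \<or> x = Keep a \<and> a \<in> HD) \<and>
       (\<nexists>a. erev x = SideL a \<or> erev x = EndR a \<or> erev x = Keep a \<and> a \<in> HD)"
      using eface_cells erev_in by (simp cong: conj_cong)
    also have "\<dots> \<longleftrightarrow> x \<in> Keep ` PD" by (cases x) (auto simp: PD_def)
    finally show "x \<in> {x \<in> ED. eface x \<notin> cells \<and> eface (erev x) \<notin> cells} \<longleftrightarrow> x \<in> Keep ` PD" .
  qed
  finally show ?thesis .
qed

lemma Keep_PD_in: "a \<in> PD \<Longrightarrow> Keep a \<in> ED"
  by (simp add: PD_def)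

lemma tail_P: "tail (graph_of P) = eface"
  by (simp add: parent_def inverse_leapfrog_def Let_def)

lemma head_P: "a \<in> PD \<Longrightarrow> head (graph_of P) (Keep a) = eface (Keep (opp a))"
  using perm_restrict_simps(1)[OF Keep_PD_in, of a erev]
  by (simp add: parent_def inverse_leapfrog_def Let_def)

lemma P_fields: "edge_rev P = perm_restrict (edge_rev E) (darts P)"
    "edge_succ P = perm_restrict (first_return ephi (darts P)) (darts P)"
  by (simp_all add: parent_def inverse_leapfrog_def Let_def)

lemma rev_P: "a \<in> PD \<Longrightarrow> edge_rev P (Keep a) = Keep (opp a)"
  using perm_restrict_simps(1)[OF Keep_PD_in, of a erev]
  unfolding P_fields darts_P by (simp add: perm_restrict_simps(1))

text \<open>As in a leapfrog graph, every second edge of a surviving face borders a deleted one. The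
  vertex that \<open>a\<close> leads to decides which edge lies between: a new \<open>EndL\<close>,
  the copy \<open>SideR\<close> of a matched edge, or an edge of a hexagon of \<open>H\<close>. So
  the first return always takes two steps.\<close>

lemma ephi_PD:
  assumes "a \<in> PD"
  shows "ephi (Keep a) \<notin> Keep ` PD" "ephi (ephi (Keep a)) = Keep (nxt a)"
proof -
  have a: "a \<in> D" "a \<notin> MD" using assms by (auto simp: PD_def)
  have "opp a \<in> PD" using assms by simp
  then have "ephi (Keep a) \<notin> Keep ` PD \<and> ephi (ephi (Keep a)) = Keep (nxt a)"
  proof (cases rule: PD_cases)
    case (M1 x)
    then have p: "phi a = rot (rot x)" by (simp add: face_succ_def)
    then show ?thesis using a M1 rot_MD[OF M1(1)] PD_M[OF M1(1)]
      by (auto simp: ephi_Keep ephi_Side_End nxt_def)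
  next
    case (M2 x)
    then have p: "phi a = x" by (simp add: face_succ_def)
    then show ?thesis using a M2 MD_not_PD[OF M2(1)]
      by (auto simp: ephi_Keep ephi_Side_End nxt_def)
  next
    case (H x)
    then have p: "phi a = rot (rot x)" by (simp add: face_succ_def)
    have h: "opp (phi a) \<in> HD" using H(1) p by (simp add: opp_HD)
    then have pp: "phi (phi a) = rot (opp (phi a))" by (simp add: face_succ_def)
    have e1: "ephi (Keep a) = Keep (phi a)" using a p PD_H(4,6)[OF H(1)] by (simp add: ephi_Keep)
    have "ephi (Keep (phi a)) = Keep (phi (phi a))"
      using HD_in[OF H(1)] PD_H(4)[OF H(1)] PD_H(4,5)[OF h] p pp by (simp add: ephi_Keep)
    then show ?thesis using e1 PD_H(2)[OF H(1)] p by (auto simp: nxt_def)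
  qed
  then show "ephi (Keep a) \<notin> Keep ` PD" "ephi (ephi (Keep a)) = Keep (nxt a)" by simp_all
qed

lemma succ_P: assumes "a \<in> PD" shows "edge_succ P (Keep a) = Keep (nxt a)"
proof -
  have "first_return ephi (Keep ` PD) (Keep a) = (ephi ^^ 2) (Keep a)"
    unfolding first_return_def
  proof (subst Least_equality[where x = 2])
    show "0 < (2::nat) \<and> (ephi ^^ 2) (Keep a) \<in> Keep ` PD"
      using ephi_PD(2)[OF assms] nxt_PD[OF assms] by (simp add: numeral_2_eq_2)
    show "2 \<le> k" if "0 < k \<and> (ephi ^^ k) (Keep a) \<in> Keep ` PD" for k
    proof (rule ccontr)
      assume "\<not> 2 \<le> k"
      then have "k = 1" using that by simp
      then show False using that ephi_PD(1)[OF assms] by simp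
    qed
  qed simp
  then show ?thesis unfolding P_fields darts_P using assms ephi_PD(2)[OF assms]
    by (simp add: perm_restrict_simps numeral_2_eq_2)
qed

lemma face_succ_P: "a \<in> PD \<Longrightarrow> face_succ P (Keep a) = Keep (psi a)"
  by (simp add: face_succ_def rev_P succ_P psi_def)

lemma degree_P: "degree P v = card {a \<in> PD. eface (Keep a) = v}"
proof -
  have "out_arcs (graph_of P) v = Keep ` {a \<in> PD. eface (Keep a) = v}"
    unfolding out_arcs_def darts_P tail_P by auto
  then show ?thesis by (simp add: out_degree_def card_image inj_on_def)
qed

lemma star_P: "a \<in> PD \<Longrightarrow> {b \<in> PD. eface (Keep b) = eface (Keep a)} = face_of G a \<inter> PD"
  by (rule Collect_cong[where Q = "\<lambda>b. b \<in> face_of G a \<and> b \<in> PD", unfolded Collect_conj_eq Collect_mem_eq])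
    (use eface_PD_iff[of _ a] face_eq_iff[of _ a] in metis)

lemma degree_P_eface: "a \<in> PD \<Longrightarrow> degree P (eface (Keep a)) = card (face_of G a \<inter> PD)"
  by (simp add: degree_P star_P)

section \<open>The parent is a connected simple map\<close>

lemma wf_P: "wf_digraph (graph_of P)"
  by unfold_locales (auto simp: darts_P tail_P head_P verts_P)

lemma fin_P: "fin_digraph (graph_of P)"
  using wf_P by (intro fin_digraph.intro fin_digraph_axioms.intro) (simp_all add: verts_P darts_P)

lemma rev_P_out: "x \<notin> darts P \<Longrightarrow> edge_rev P x = x" and succ_P_out: "x \<notin> darts P \<Longrightarrow> edge_succ P x = x"
  by (simp_all add: P_fields perm_restrict_simps)

lemma bidirected_P: "bidirected_digraph (graph_of P) (edge_rev P)"
proof (rule wf_digraph.bidirected_digraphI[OF wf_P])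
  fix x assume "x \<in> darts P"
  then obtain a where a: "a \<in> PD" "x = Keep a" by (auto simp: darts_P)
  show "edge_rev P x \<noteq> x" using a rev_P bi.arev_neq PD_in by simp
  show "edge_rev P (edge_rev P x) = x" using a rev_P by simp
  show "tail (graph_of P) (edge_rev P x) = head (graph_of P) x" using a by (simp add: rev_P head_P tail_P)
qed (rule rev_P_out)

text \<open>Loops are excluded because an edge has different faces on its sides, parallel edges
  because two faces share at most one edge.\<close>

lemma graph_P: "Digraph.graph (graph_of P)"
proof -
  interpret fin_digraph "graph_of P" by (rule fin_P)
  interpret bp: bidirected_digraph "graph_of P" "edge_rev P" by (rule bidirected_P)
  show ?thesis
  proof unfold_locales
    show "tail (graph_of P) x \<noteq> head (graph_of P) x" if x: "x \<in> darts P" for x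
    proof -
      obtain a where a: "a \<in> PD" "x = Keep a" using x unfolding darts_P by blast
      then show ?thesis using eface_PD_iff[of a "opp a"] face_opp_neq[of a] PD_in by (auto simp: tail_P head_P)
    qed
    show "x = y" if xy: "x \<in> darts P" "y \<in> darts P" "arc_to_ends (graph_of P) x = arc_to_ends (graph_of P) y" for x y
    proof -
      obtain a where a: "a \<in> PD" "x = Keep a" using xy(1) unfolding darts_P by blast
      obtain b where b: "b \<in> PD" "y = Keep b" using xy(2) unfolding darts_P by blast
      have "eface (Keep a) = eface (Keep b)" "eface (Keep (opp a)) = eface (Keep (opp b))"
        using xy(3) a b by (auto simp: arc_to_ends_def tail_P head_P)
      then have "a = b" using a(1) b(1) PD_in by (intro faces_share_one_edge) (auto simp: eface_PD_iff)
      then show ?thesis using a b by simp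
    qed
  qed
qed

lemma succ_P_permutes: "edge_succ P permutes darts P"
proof (rule bij_imp_permutes)
  have "inj_on (edge_succ P) (darts P)"
    using nxt_inj by (auto simp: darts_P inj_on_def succ_P)
  moreover have "edge_succ P ` darts P \<subseteq> darts P"
    by (auto simp: darts_P succ_P nxt_PD)
  ultimately show "bij_betw (edge_succ P) (darts P) (darts P)"
    using fin_digraph.finite_arcs[OF fin_P] by (simp add: bij_betw_def endo_inj_surj)
qed (rule succ_P_out)

lemma face_succ_P_permutation: "permutation (face_succ P)"
proof -
  interpret bp: bidirected_digraph "graph_of P" "edge_rev P" by (rule bidirected_P)
  have "edge_succ P \<circ> edge_rev P permutes darts P"
    using bp.arev_permutes_arcs succ_P_permutes by (rule permutes_compose)
  moreover have "edge_succ P \<circ> edge_rev P = face_succ P" by (auto simp: face_succ_def)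
  ultimately show ?thesis
    using fin_digraph.finite_arcs[OF fin_P] by (metis permutation_permutes)
qed

lemma succ_P_cyclic:
  assumes "v \<in> vertices P"
  shows "cyclic_on (edge_succ P) (out_arcs (graph_of P) v)"
proof -
  obtain a where a: "a \<in> PD" "v = eface (Keep a)" using assms by (auto simp: verts_P)
  have "out_arcs (graph_of P) v = Keep ` {b \<in> PD. eface (Keep b) = v}"
    unfolding out_arcs_def darts_P tail_P by auto
  also have "\<dots> = Keep ` orbit nxt a" using a face_inter_PD_nxt star_P by simp
  also have "\<dots> = orbit (edge_succ P) (Keep a)"
  proof (rule orbit_inverse)
    show "a \<in> orbit nxt a" using a face_inter_PD_nxt by simp
    show "edge_succ P (Keep x) = Keep (nxt x)" if "x \<in> orbit nxt a" for x
      using that a face_inter_PD_nxt by (simp add: succ_P)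
  qed
  finally have o: "out_arcs (graph_of P) v = orbit (edge_succ P) (Keep a)" .
  have "Keep a \<in> out_arcs (graph_of P) v" using a by (simp add: darts_P tail_P)
  then show ?thesis using o unfolding cyclic_on_def by blast
qed

lemma connected_P: "Digraph_Component.connected (graph_of P)"
proof -
  have "(u, v) \<in> rtrancl_on (vertices P) ((arcs_ends (graph_of P))\<^sup>s)"
    if u: "u \<in> vertices P" and v: "v \<in> vertices P" for u v
  proof -
    let ?R = "\<lambda>w. (u, w) \<in> rtrancl_on (vertices P) ((arcs_ends (graph_of P))\<^sup>s)"
    define T where "T = {a \<in> PD. ?R (eface (Keep a))}"
    have "T = PD"
    proof (rule PD_connected)
      show "T \<subseteq> PD" by (auto simp: T_def)
      obtain a where a: "a \<in> PD" "u = eface (Keep a)" using u by (auto simp: verts_P)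
      have "?R u" using u by (rule rtrancl_on_refl)
      then show "T \<noteq> {}" using a by (auto simp: T_def)
      fix b assume b: "b \<in> T"
      then have bP: "b \<in> PD" "?R (eface (Keep b))" by (auto simp: T_def)
      have "(eface (Keep b), eface (Keep (opp b))) \<in> (arcs_ends (graph_of P))\<^sup>s"
        using bP(1) by (auto simp: symcl_def arcs_ends_conv darts_P tail_P head_P)
      moreover have "eface (Keep (opp b)) \<in> vertices P" using bP by (auto simp: verts_P)
      ultimately have "?R (eface (Keep (opp b)))" by (rule rtrancl_on_into_rtrancl_on[OF bP(2)])
      then show "opp b \<in> T" using bP by (simp add: T_def)
      have "eface (Keep (nxt b)) = eface (Keep b)" using bP(1) nxt_PD by (simp add: eface_PD_iff)
      then show "nxt b \<in> T" using bP nxt_PD by (simp add: T_def)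
    qed
    then show ?thesis using v by (auto simp: verts_P T_def)
  qed
  moreover have "vertices P \<noteq> {}"
  proof -
    obtain v where "v \<in> V" using V_nonempty by blast
    then have "PD \<noteq> {}" using PD_M(1) PD_H(1) by (cases rule: vertex_cases) blast+
    then show ?thesis by (simp add: verts_P)
  qed
  ultimately show ?thesis by (simp add: connected_conv)
qed

lemma psi_self: assumes "a \<in> PD" shows "a \<in> orbit psi a"
  using assms
proof (cases rule: PD_cases)
  case (M1 x) then show ?thesis by (simp add: psi_orbit_M)
next
  case (M2 x) then show ?thesis by (simp add: psi_orbit_M)
next
  case (H x) then show ?thesis by (simp add: psi_orbit_H)
qed

lemma face_P: assumes "a \<in> PD" shows "face_of P (Keep a) = Keep ` orbit psi a"
proof -
  have "Keep ` orbit psi a = orbit (face_succ P) (Keep a)"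
  proof (rule orbit_inverse)
    show "a \<in> orbit psi a" using assms by (rule psi_self)
    fix x assume "x \<in> orbit psi a"
    then have "x \<in> PD"
      by induction (use assms nxt_PD in \<open>auto simp: psi_def\<close>)
    then show "face_succ P (Keep x) = Keep (psi x)" by (rule face_succ_P)
  qed
  then show ?thesis by (simp add: face_of_def)
qed

section \<open>Faces of the parent and Euler's formula\<close>

abbreviation quad :: "'d \<Rightarrow> 'd set" where
  "quad x \<equiv> {rot x, rot (rot x), rot (opp x), rot (rot (opp x))}"

lemma faces_P: "faces P = (\<lambda>x. Keep ` quad x) ` MD \<union> (\<lambda>x. Keep ` rot ` face_of G x) ` HD"
proof -
  have "faces P = (\<lambda>a. Keep ` orbit psi a) ` PD"
    unfolding faces_def darts_P image_image by (rule image_cong) (simp_all add: face_P)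
  also have "\<dots> = (\<lambda>x. Keep ` quad x) ` MD \<union> (\<lambda>x. Keep ` rot ` face_of G x) ` HD"
  proof
    show "(\<lambda>a. Keep ` orbit psi a) ` PD \<subseteq> (\<lambda>x. Keep ` quad x) ` MD \<union> (\<lambda>x. Keep ` rot ` face_of G x) ` HD"
    proof (rule image_subsetI)
      fix a assume "a \<in> PD"
      then show "Keep ` orbit psi a \<in> (\<lambda>x. Keep ` quad x) ` MD \<union> (\<lambda>x. Keep ` rot ` face_of G x) ` HD"
      proof (cases rule: PD_cases)
        case (M1 x)
        then have "Keep ` orbit psi a = Keep ` quad x" by (simp add: psi_orbit_M)
        then show ?thesis using M1(1) by blast
      next
        case (M2 x)
        then have "Keep ` orbit psi a = Keep ` quad x" by (simp add: psi_orbit_M)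
        then show ?thesis using M2(1) by blast
      next
        case (H x)
        then have "Keep ` orbit psi a = Keep ` rot ` face_of G x" by (simp add: psi_orbit_H)
        then show ?thesis using H(1) by blast
      qed
    qed
    show "(\<lambda>x. Keep ` quad x) ` MD \<union> (\<lambda>x. Keep ` rot ` face_of G x) ` HD \<subseteq> (\<lambda>a. Keep ` orbit psi a) ` PD"
    proof (rule Un_least; rule image_subsetI)
      fix x assume x: "x \<in> MD"
      have "Keep ` quad x = Keep ` orbit psi (rot x)" using psi_orbit_M(1)[OF x] by simp
      then show "Keep ` quad x \<in> (\<lambda>a. Keep ` orbit psi a) ` PD" using PD_M(1)[OF x] by blast
    next
      fix x assume x: "x \<in> HD"
      have "Keep ` rot ` face_of G x = Keep ` orbit psi (rot x)" using psi_orbit_H[OF x] by simp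
      then show "Keep ` rot ` face_of G x \<in> (\<lambda>a. Keep ` orbit psi a) ` PD" using PD_H(1)[OF x] by blast
    qed
  qed
  finally show ?thesis .
qed

lemma is_gon_Keep:
  assumes "S \<subseteq> PD"
  shows "is_gon k P (Keep ` S) \<longleftrightarrow> card S = k \<and> inj_on (face_of G) S"
proof -
  have "inj_on eface (Keep ` S) \<longleftrightarrow> inj_on (face_of G) S"
    using assms eface_PD_iff by (auto simp: inj_on_def subset_iff)
  then show ?thesis by (simp add: is_gon_def tail_P card_image inj_on_def)
qed

lemma quad_PD: "x \<in> MD \<Longrightarrow> quad x \<subseteq> PD"
  using PD_M[of x] PD_M[of "opp x"] by simp

lemma hexagon_PD: "x \<in> HD \<Longrightarrow> rot ` face_of G x \<subseteq> PD"
  using PD_H(1) face_HD by blast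

lemma gon_quad: "x \<in> MD \<Longrightarrow> is_gon 4 P (Keep ` quad x)"
  using is_gon_Keep[OF quad_PD] face_inj_quad by simp

lemma gon_hexagon: "x \<in> HD \<Longrightarrow> is_gon 6 P (Keep ` rot ` face_of G x)"
  using is_gon_Keep[OF hexagon_PD] face_inj_hexagon by simp

lemma faces_P_gon: "f \<in> faces P \<Longrightarrow> is_gon 4 P f \<or> is_gon 6 P f"
  unfolding faces_P using gon_quad gon_hexagon by blast

lemma not_gon_4_6: "is_gon 4 P f \<Longrightarrow> is_gon 6 P f \<Longrightarrow> False"
  by (simp add: is_gon_def)

lemma quads_P: "{f \<in> faces P. is_gon 4 P f} = (\<lambda>x. Keep ` quad x) ` MD"
  and hexagons_P: "{f \<in> faces P. is_gon 6 P f} = (\<lambda>x. Keep ` rot ` face_of G x) ` HD"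
  unfolding faces_P using gon_quad gon_hexagon not_gon_4_6 by blast+

lemma faces_P_disjoint:
  assumes "f \<in> faces P" "g \<in> faces P" "f \<noteq> g" shows "f \<inter> g = {}"
  using assms orbit_eq_iff[OF face_succ_P_permutation] by (auto simp: faces_def face_of_def)

lemma finite_faces_P: "finite (faces P)"
  by (simp add: faces_P)

text \<open>\<open>x\<close> and \<open>opp x\<close> describe the same quadrilateral. Instead of
  dividing the index set, the darts are counted: quadrilaterals are disjoint, have 4 darts each, and
  use two darts per element of \<open>MD\<close>.\<close>

lemma card_quads_P: "2 * card {f \<in> faces P. is_gon 4 P f} = card MD"
proof -
  let ?Q = "{f \<in> faces P. is_gon 4 P f}"
  have U: "\<Union> ?Q = Keep ` (rot ` MD \<union> (\<lambda>x. rot (rot x)) ` MD)"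
  proof
    show "\<Union> ?Q \<subseteq> Keep ` (rot ` MD \<union> (\<lambda>x. rot (rot x)) ` MD)"
    proof
      fix y assume "y \<in> \<Union> ?Q"
      then obtain x where "x \<in> MD" "y \<in> Keep ` quad x" unfolding quads_P by blast
      moreover from this have "opp x \<in> MD" by simp
      ultimately show "y \<in> Keep ` (rot ` MD \<union> (\<lambda>x. rot (rot x)) ` MD)" by blast
    qed
    show "Keep ` (rot ` MD \<union> (\<lambda>x. rot (rot x)) ` MD) \<subseteq> \<Union> ?Q" unfolding quads_P by blast
  qed
  have i: "inj_on rot S" "inj_on (\<lambda>x. rot (rot x)) S" for S by (simp_all add: inj_on_def rot_inj)
  have "rot ` MD \<inter> (\<lambda>x. rot (rot x)) ` MD = {}"
    using PD_M(1) MD_not_PD by (auto simp: rot_inj) blast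
  then have c: "card (rot ` MD \<union> (\<lambda>x. rot (rot x)) ` MD) = 2 * card MD"
    by (simp add: card_Un_disjoint card_image[OF i(1)] card_image[OF i(2)])
  have "4 * card ?Q = card (\<Union> ?Q)"
  proof (rule card_partition)
    show "finite ?Q" using finite_faces_P by simp
    show "finite (\<Union> ?Q)" unfolding U by simp
    show "card c = 4" if "c \<in> ?Q" for c using that by (simp add: is_gon_def)
    show "c1 \<inter> c2 = {}" if "c1 \<in> ?Q" "c2 \<in> ?Q" "c1 \<noteq> c2" for c1 c2
      using that faces_P_disjoint by blast
  qed
  also have "\<dots> = 2 * card MD" unfolding U using c by (simp add: card_image inj_on_def)
  finally show ?thesis by simp
qed

lemma card_hexagons_P: "card {f \<in> faces P. is_gon 6 P f} = card H"
proof -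
  let ?Q = "{f \<in> faces P. is_gon 6 P f}"
  have U: "\<Union> ?Q = Keep ` rot ` HD"
  proof
    show "\<Union> ?Q \<subseteq> Keep ` rot ` HD"
    proof
      fix y assume "y \<in> \<Union> ?Q"
      then obtain x z where "x \<in> HD" "z \<in> face_of G x" "y = Keep (rot z)" unfolding hexagons_P by blast
      moreover from this have "z \<in> HD" using face_HD by blast
      ultimately show "y \<in> Keep ` rot ` HD" by blast
    qed
    show "Keep ` rot ` HD \<subseteq> \<Union> ?Q" unfolding hexagons_P using self_in_face by blast
  qed
  have "6 * card ?Q = card (\<Union> ?Q)"
  proof (rule card_partition)
    show "finite ?Q" using finite_faces_P by simp
    show "finite (\<Union> ?Q)" unfolding U by simp
    show "card c = 6" if "c \<in> ?Q" for c using that by (simp add: is_gon_def)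
    show "c1 \<inter> c2 = {}" if "c1 \<in> ?Q" "c2 \<in> ?Q" "c1 \<noteq> c2" for c1 c2
      using that faces_P_disjoint by blast
  qed
  also have "\<dots> = card HD" unfolding U by (simp add: card_image inj_on_def rot_inj)
  finally show ?thesis using card_HD by simp
qed

lemma card_faces_P: "2 * card (faces P) = card MD + 2 * card H"
proof -
  let ?A = "{f \<in> faces P. is_gon 4 P f}" and ?B = "{f \<in> faces P. is_gon 6 P f}"
  have "faces P = ?A \<union> ?B" using faces_P_gon by blast
  moreover have "card (?A \<union> ?B) = card ?A + card ?B"
    by (rule card_Un_disjoint) (use finite_faces_P not_gon_4_6 in auto)
  ultimately have "card (faces P) = card ?A + card ?B" by simp
  then show ?thesis using card_quads_P card_hexagons_P by simp
qed

text \<open>Vertices of the parent are faces of the expansion, not of the fullerene. By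
  \<open>eface_PD_iff\<close> both kinds identify the same parent darts, which is all that counting
  them requires.\<close>

lemma card_image_eq:
  assumes "\<And>x y. x \<in> A \<Longrightarrow> y \<in> A \<Longrightarrow> f x = f y \<longleftrightarrow> g x = g y"
  shows "card (f ` A) = card (g ` A)"
proof -
  have s: "f (SOME x. x \<in> A \<and> g x = g a) = f a" if "a \<in> A" for a
    using someI[of "\<lambda>x. x \<in> A \<and> g x = g a" a] that assms[of _ a] by blast
  have "bij_betw (\<lambda>v. f (SOME x. x \<in> A \<and> g x = v)) (g ` A) (f ` A)"
  proof (rule bij_betw_imageI)
    show "inj_on (\<lambda>v. f (SOME x. x \<in> A \<and> g x = v)) (g ` A)"
    proof (rule inj_onI, elim imageE)
      fix v w a b assume "v = g a" "w = g b" "a \<in> A" "b \<in> A"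
        "f (SOME x. x \<in> A \<and> g x = v) = f (SOME x. x \<in> A \<and> g x = w)"
      then show "v = w" using s[of a] s[of b] assms[of a b] by simp
    qed
    show "(\<lambda>v. f (SOME x. x \<in> A \<and> g x = v)) ` g ` A = f ` A"
      unfolding image_image by (rule image_cong) (simp_all add: s)
  qed
  then show ?thesis by (simp add: bij_betw_same_card)
qed

lemma card_verts_P: "card (vertices P) + card H = card (faces G)"
proof -
  have "card (vertices P) = card (face_of G ` PD)"
    unfolding verts_P by (rule card_image_eq) (rule eface_PD_iff)
  then have "card (vertices P) = card (faces G) - card H"
    unfolding faces_PD using H_faces by (simp add: card_Diff_subset)
  moreover have "card H \<le> card (faces G)" using H_faces by (simp add: card_mono)
  ultimately show ?thesis by simp
qed

lemma card_faces: "2 * card (faces G) = card V + 4"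
  using euler card_edges card_D by linarith

lemma card_edges_P: "2 * card (edges P) = card PD"
  using card_edges_bidirected[OF fin_P bidirected_P] by (simp add: darts_P card_image inj_on_def)

lemma plane_P: "plane_graph P"
proof -
  \<comment> \<open>Both sides equal \<open>card PD + 4\<close>; the 4 stems from
    \<open>card_faces\<close>, that is, from Euler's formula for the fullerene.\<close>
  have "2 * card (vertices P) + 2 * card (faces P) = 2 * card (edges P) + 4"
    unfolding card_edges_P card_faces_P using card_verts_P card_faces card_V card_HD card_PD by simp
  then have "int (card (vertices P)) - int (card (edges P)) + int (card (faces P)) = 2" by linarith
  then show ?thesis
    unfolding plane_graph_def
    using graph_P bidirected_P succ_P_permutes succ_P_cyclic connected_P by simp
qed

end

text \<open>The boundary has as many edges as darts, since no face meets an edge from both sides;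
  half of them lying in \<open>N\<close> makes the number even, which excludes pentagons.\<close>

lemma (in fullerene_map) alternating_hexagon:
  assumes "f \<in> faces G" "alternating G N f" shows "card f = 6"
proof -
  obtain a where a: "a \<in> D" "f = face_of G a" using assms(1) by (rule facesE)
  have "inj_on (edge_of G) f"
  proof (rule inj_onI)
    fix x y assume xy: "x \<in> f" "y \<in> f" "edge_of G x = edge_of G y"
    have "x \<noteq> opp y"
    proof
      assume "x = opp y"
      then have "opp y \<in> face_of G y" using xy face_of_mem[OF assms(1)] by simp
      then show False using opp_notin_face mem_face_in[OF assms(1) xy(2)] by blast
    qed
    then show "x = y" using xy(3) by (simp add: edge_of_eq_iff)
  qed
  then have "card (face_edges G f) = card f" by (simp add: face_edges_def card_image)
  then have "even (card f)" using assms(2) unfolding alternating_def by (metis dvd_triv_left)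
  then show ?thesis using card_face[OF a(1)] a(2) by auto
qed

context clar_map
begin

section \<open>Degrees, bipartition and quadrilaterals at vertices of degree four\<close>

lemma degree_P_ge_3: "v \<in> vertices P \<Longrightarrow> 3 \<le> degree P v"
proof -
  assume "v \<in> vertices P"
  then obtain a where a: "a \<in> PD" "v = eface (Keep a)" by (auto simp: verts_P)
  have "a \<in> D" "a \<notin> HD" using a(1) by (simp_all add: PD_def)
  then show ?thesis using a card_face_inter_PD(2) by (simp add: degree_P_eface)
qed

lemma sum_degree_P:
  assumes "A \<subseteq> vertices P"
  shows "(\<Sum>v\<in>A. degree P v) = card {a \<in> PD. eface (Keep a) \<in> A}"
proof -
  have fin: "finite A" using assms finite_subset fin_digraph.finite_verts[OF fin_P] by blast
  have "{a \<in> PD. eface (Keep a) \<in> A} = (\<Union>v\<in>A. {a \<in> PD. eface (Keep a) = v})" by blast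
  also have "card \<dots> = (\<Sum>v\<in>A. card {a \<in> PD. eface (Keep a) = v})"
    using fin by (intro card_UN_disjoint) auto
  finally show ?thesis by (simp add: degree_P)
qed

lemma P_even_cut: "\<exists>A. A \<subseteq> vertices P \<and> bipartition P A (vertices P - A)"
proof -
  interpret Q: plane_map P using plane_P by unfold_locales
  have "edges P \<in> Q.even_sets"
  proof -
    have "even (card {a \<in> f. edge_of P a \<in> edges P})" if f: "f \<in> faces P" for f
    proof -
      have "{a \<in> f. edge_of P a \<in> edges P} = f" using Q.mem_face_in[OF f] by (auto simp: edges_def)
      then show ?thesis using faces_P_gon[OF f] by (auto simp: is_gon_def)
    qed
    then show ?thesis by (auto simp: Q.even_sets_def Q.odd_faces_def)
  qed
  then obtain A where A: "A \<subseteq> vertices P" "edges P = Q.edge_cut A" by (rule Q.even_set_is_cut)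
  have "bipartition P A (vertices P - A)"
    unfolding bipartition_def
  proof (intro conjI ballI)
    fix a assume a: "a \<in> darts P"
    then have "edge_of P a \<in> Q.edge_cut A" using A(2) by (auto simp: edges_def)
    then have "(tail (graph_of P) a \<in> A) \<noteq> (head (graph_of P) a \<in> A)"
      using Q.edge_in_cut_iff[OF a] by simp
    then show "tail (graph_of P) a \<in> A \<longleftrightarrow> head (graph_of P) a \<in> vertices P - A"
      using Q.gr.head_in_verts[OF a] by blast
  qed (use A(1) in auto)
  then show ?thesis using A(1) by blast
qed

text \<open>\<open>opp\<close> exchanges the darts that leave the two classes.\<close>

lemma bipartition_sum_degree:
  assumes "bipartition P A B"
  shows "(\<Sum>v\<in>A. degree P v) = (\<Sum>v\<in>B. degree P v)"
proof -
  have AB: "A \<subseteq> vertices P" "B \<subseteq> vertices P" using assms by (auto simp: bipartition_def)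
  have *: "eface (Keep a) \<in> A \<longleftrightarrow> eface (Keep (opp a)) \<in> B" if "a \<in> PD" for a
    using assms that unfolding bipartition_def darts_P tail_P by (simp add: head_P)
  have "bij_betw opp {a \<in> PD. eface (Keep a) \<in> A} {a \<in> PD. eface (Keep a) \<in> B}"
    by (rule bij_betw_byWitness[of _ opp]) (auto simp: *)
  then show ?thesis unfolding sum_degree_P[OF AB(1)] sum_degree_P[OF AB(2)] by (rule bij_betw_same_card)
qed

lemma quads_at_degree_4:
  assumes "v \<in> vertices P" "degree P v = 4"
  shows "2 \<le> card {f \<in> faces P. is_gon 4 P f \<and> v \<in> face_verts P f}"
proof -
  obtain a where a: "a \<in> PD" "v = eface (Keep a)" using assms(1) by (auto simp: verts_P)
  have aD: "a \<in> D" using a(1) by (rule PD_in)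
  let ?f = "face_of G a"
  have fin: "finite ?f" using aD face_in_faces by simp
  have c4: "card (?f \<inter> PD) = 4" using assms(2) a by (simp add: degree_P_eface)
  \<comment> \<open>The surviving darts of the face whose predecessor survives too. At most 6 - 4 =
    2 darts of the face are skipped and each spoils one successor, so at least 4 - 2 = 2
    remain.\<close>
  define X where "X = (?f \<inter> PD) - phi ` (?f - PD)"
  have "card ?f = card (?f \<inter> PD) + card (?f - PD)" using fin by (rule card_Int_Diff)
  then have "card (phi ` (?f - PD)) \<le> 2"
    using c4 card_face[OF aD] card_image_le[of "?f - PD" phi] fin by auto
  moreover have "card (?f \<inter> PD) - card (phi ` (?f - PD)) \<le> card X"
    unfolding X_def using fin by (intro diff_card_le_card_Diff) simp
  ultimately have X2: "2 \<le> card X" using c4 by simp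
  have X: "Keep b \<in> face_of P (Keep b)" "face_of P (Keep b) \<in> {f \<in> faces P. is_gon 4 P f}"
      "eface (Keep b) = v" if b: "b \<in> X" for b
  proof -
    have bP: "b \<in> PD" "b \<in> ?f" "b \<notin> phi ` (?f - PD)" using b by (auto simp: X_def)
    obtain c where c: "b = phi c" using phi_permutes by (metis permutes_surj surjD)
    then have "c \<in> ?f" using bP(2) by simp
    then have "c \<in> PD" using bP(3) c by blast
    then have "opp c \<in> PD" by simp
    \<comment> \<open>Here \<open>b\<close> is \<open>rot (opp c)\<close>. Were \<open>opp c\<close>
      the second dart after a matched one, \<open>b\<close> would be matched; at a vertex of a
      hexagon of \<open>H\<close>, \<open>b\<close> would run along the hexagon. Only the position
      inside a quadrilateral remains.\<close>
    then obtain x where x: "x \<in> MD" "b = rot (rot x)"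
    proof (cases rule: PD_cases)
      case (M1 x) then show ?thesis using that c by (simp add: face_succ_def)
    next
      case (M2 x)
      then have "b = x" using c by (simp add: face_succ_def)
      then show ?thesis using M2 bP MD_not_PD by blast
    next
      case (H x)
      then have "b = rot (rot x)" using c by (simp add: face_succ_def)
      then show ?thesis using H bP PD_H(2) by blast
    qed
    have f: "face_of P (Keep b) = Keep ` quad x"
      using face_P[OF bP(1)] psi_orbit_M(2)[OF x(1)] x(2) by simp
    show "Keep b \<in> face_of P (Keep b)" unfolding f by (simp add: x(2))
    show "face_of P (Keep b) \<in> {f \<in> faces P. is_gon 4 P f}" unfolding f quads_P using x(1) by blast
    show "eface (Keep b) = v" using a bP by (simp add: eface_PD_iff face_eq_iff)
  qed
  have "card X \<le> card {f \<in> faces P. is_gon 4 P f \<and> v \<in> face_verts P f}"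
  proof (rule card_inj_on_le)
    \<comment> \<open>The boundary of a quadrilateral is a cycle and passes \<open>v\<close> only
      once, so different darts at \<open>v\<close> give different quadrilaterals.\<close>
    show "inj_on (\<lambda>b. face_of P (Keep b)) X"
    proof (rule inj_onI)
      fix b c assume bc: "b \<in> X" "c \<in> X" "face_of P (Keep b) = face_of P (Keep c)"
      have "inj_on eface (face_of P (Keep b))" using X(2)[OF bc(1)] by (simp add: is_gon_def tail_P)
      moreover have "Keep b \<in> face_of P (Keep b)" "Keep c \<in> face_of P (Keep b)"
        using X(1)[OF bc(1)] X(1)[OF bc(2)] bc(3) by simp_all
      ultimately have "Keep b = Keep c" using X(3)[OF bc(1)] X(3)[OF bc(2)] by (metis inj_onD)
      then show "b = c" by simp
    qed
    show "(\<lambda>b. face_of P (Keep b)) ` X \<subseteq> {f \<in> faces P. is_gon 4 P f \<and> v \<in> face_verts P f}"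
    proof (rule image_subsetI)
      fix b assume b: "b \<in> X"
      have "v \<in> face_verts P (face_of P (Keep b))"
        unfolding face_verts_def tail_P using X(1,3)[OF b] by (metis imageI)
      then show "face_of P (Keep b) \<in> {f \<in> faces P. is_gon 4 P f \<and> v \<in> face_verts P f}"
        using X(2)[OF b] by simp
    qed
    show "finite {f \<in> faces P. is_gon 4 P f \<and> v \<in> face_verts P f}" using finite_faces_P by simp
  qed
  then show ?thesis using X2 by simp
qed

end

section \<open>Degree counting with sixteen matched vertices\<close>

lemma sum_excess:
  fixes g :: "'a \<Rightarrow> nat"
  assumes "\<And>v. v \<in> A \<Longrightarrow> k \<le> g v"
  shows "sum g A = k * card A + (\<Sum>v\<in>A. g v - k)"
proof -
  have "sum g A = (\<Sum>v\<in>A. k + (g v - k))" using assms by (intro sum.cong) auto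
  then show ?thesis by (simp add: sum.distrib)
qed

text \<open>Matched darts correspond to the vertices off \<open>H\<close>, so 16 of them mean 8
  edges in \<open>M\<close>.\<close>

locale clar_map_16 = clar_map +
  assumes card_MD: "card MD = 16"
begin

lemma card_verts_P_16: "card V = 6 * card H + 16" "card (vertices P) = 2 * card H + 10"
  using card_V card_HD card_MD card_verts_P card_faces by simp_all

text \<open>The degrees of the two colour classes sum up to the same number and exceed three by two in
  total. Since the excesses are congruent modulo 3, both are 1.\<close>

lemma bipartition_excess:
  assumes "bipartition P A B"
  shows "(\<Sum>v\<in>A. degree P v - 3) = 1" "(\<Sum>v\<in>B. degree P v - 3) = 1"
proof -
  have AB: "A \<union> B = vertices P" "A \<inter> B = {}" using assms by (auto simp: bipartition_def)
  have fin: "finite A" "finite B"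
    using AB(1) fin_digraph.finite_verts[OF fin_P] by (metis finite_Un)+
  let ?a = "\<Sum>v\<in>A. degree P v - 3" and ?b = "\<Sum>v\<in>B. degree P v - 3"
  have a: "(\<Sum>v\<in>A. degree P v) = 3 * card A + ?a" using AB(1) by (intro sum_excess degree_P_ge_3) blast
  have b: "(\<Sum>v\<in>B. degree P v) = 3 * card B + ?b" using AB(1) by (intro sum_excess degree_P_ge_3) blast
  have "(\<Sum>v\<in>A \<union> B. degree P v) = card {a \<in> PD. eface (Keep a) \<in> A \<union> B}"
    by (rule sum_degree_P) (simp add: AB)
  moreover have "{a \<in> PD. eface (Keep a) \<in> A \<union> B} = PD" unfolding AB verts_P by blast
  ultimately have "(\<Sum>v\<in>A \<union> B. degree P v) = card PD" by simp
  moreover have "(\<Sum>v\<in>A \<union> B. degree P v) = (\<Sum>v\<in>A. degree P v) + (\<Sum>v\<in>B. degree P v)"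
    using fin AB(2) by (rule sum.union_disjoint)
  ultimately have s: "3 * card A + ?a + (3 * card B + ?b) = card PD" using a b by simp
  have "card A + card B = card (vertices P)" using card_Un_disjoint[OF fin AB(2)] AB(1) by simp
  \<comment> \<open>There are \<open>6 * card H + 32\<close> parent darts, against three times
    \<open>2 * card H + 10\<close> vertices.\<close>
  then have ab: "?a + ?b = 2" using s card_PD card_HD card_MD card_verts_P_16 by simp
  have "3 * card A + ?a = 3 * card B + ?b" using bipartition_sum_degree[OF assms] a b by simp
  then have "?a = 1 \<and> ?b = 1" using ab by presburger
  then show "?a = 1" "?b = 1" by simp_all
qed

lemma one_degree_4:
  assumes "A \<subseteq> vertices P" "(\<Sum>v\<in>A. degree P v - 3) = 1"
  shows "card {v \<in> A. degree P v = 4} = 1" "\<forall>v \<in> A. degree P v = 4 \<or> degree P v = 3"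
proof -
  have fin: "finite A" using assms(1) finite_subset fin_digraph.finite_verts[OF fin_P] by blast
  then obtain w where w: "w \<in> A" "degree P w - 3 = 1" "\<forall>b\<in>A. w \<noteq> b \<longrightarrow> degree P b - 3 = 0"
    using assms(2) sum_eq_1_iff[OF fin, of "\<lambda>v. degree P v - 3"] by blast
  \<comment> \<open>The truncated difference being 0 only bounds the degree by 3 from above;
    \<open>degree_P_ge_3\<close> gives the other half.\<close>
  have 3: "degree P b = 3" if "b \<in> A" "w \<noteq> b" for b
  proof -
    have "degree P b - 3 = 0" using w(3) that by blast
    then show ?thesis using degree_P_ge_3[of b] assms(1) that by auto
  qed
  have 4: "degree P w = 4" using w(2) by simp
  have "{v \<in> A. degree P v = 4} = {w}"
  proof (intro equalityI subsetI)
    fix x assume "x \<in> {v \<in> A. degree P v = 4}"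
    then show "x \<in> {w}" using 3[of x] by auto
  qed (use w(1) 4 in simp)
  then show "card {v \<in> A. degree P v = 4} = 1" by simp
  show "\<forall>v \<in> A. degree P v = 4 \<or> degree P v = 3" using 3 4 by metis
qed

lemma bipartition_degree_4:
  assumes "bipartition P A B"
  shows "card {v \<in> A. degree P v = 4} = 1" "card {v \<in> B. degree P v = 4} = 1"
    "\<forall>v \<in> A \<union> B. degree P v = 4 \<or> degree P v = 3"
proof -
  have AB: "A \<subseteq> vertices P" "B \<subseteq> vertices P" using assms by (auto simp: bipartition_def)
  note 1 = one_degree_4[OF AB(1) bipartition_excess(1)[OF assms]]
    one_degree_4[OF AB(2) bipartition_excess(2)[OF assms]]
  show "card {v \<in> A. degree P v = 4} = 1" "card {v \<in> B. degree P v = 4} = 1" by (rule 1)+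
  show "\<forall>v \<in> A \<union> B. degree P v = 4 \<or> degree P v = 3" using 1(2,4) by blast
qed

lemma degrees_P:
  "card {v \<in> vertices P. degree P v = 4} = 2" "\<forall>v \<in> vertices P. degree P v = 4 \<or> degree P v = 3"
proof -
  obtain A where A: "A \<subseteq> vertices P" "bipartition P A (vertices P - A)" using P_even_cut by blast
  have U: "A \<union> (vertices P - A) = vertices P" using A(1) by blast
  note d = bipartition_degree_4[OF A(2)]
  show "\<forall>v \<in> vertices P. degree P v = 4 \<or> degree P v = 3" using d(3) unfolding U .
  have "{v \<in> vertices P. degree P v = 4} =
      {v \<in> A. degree P v = 4} \<union> {v \<in> vertices P - A. degree P v = 4}" using A(1) by blast
  moreover have "finite (vertices P)" by (rule fin_digraph.finite_verts[OF fin_P])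
  moreover from this have "finite A" using A(1) finite_subset by blast
  ultimately have "card {v \<in> vertices P. degree P v = 4} =
      card {v \<in> A. degree P v = 4} + card {v \<in> vertices P - A. degree P v = 4}"
    by (simp only:) (rule card_Un_disjoint, auto)
  then show "card {v \<in> vertices P. degree P v = 4} = 2" using d(1,2) by simp
qed

end

theorem theorem4p2:
  fixes F :: "('v, 'd) embedded_graph"
    and H M :: "'d set set"
    and n :: nat
    and P :: "('d exp_dart set, 'd exp_dart) embedded_graph"
  assumes "fullerene F"
    and "n = card (vertices F)"
    and "n mod 6 = 4"
    and "int (clar_number F) = \<lfloor>real n / 6\<rfloor> - 2"
    and "clar_structure F H M"
    and "P = parent F H M"
  shows "plane_graph P \<and>
    real (card (vertices P)) = (real n + 14) / 3 \<and>
    (card {f \<in> faces P. is_gon 4 P f} = 8 \<and>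
       (\<forall>f \<in> faces P. is_gon 4 P f \<or> is_gon 6 P f)) \<and>
    (card {v \<in> vertices P. degree P v = 4} = 2 \<and>
       (\<forall>v \<in> vertices P. degree P v = 4 \<or> degree P v = 3)) \<and>
    (\<forall>v \<in> vertices P. degree P v = 4 \<longrightarrow>
       2 \<le> card {f \<in> faces P. is_gon 4 P f \<and> v \<in> face_verts P f}) \<and>
    ((\<exists>A B. bipartition P A B) \<and>
       (\<forall>A B. bipartition P A B \<longrightarrow>
          card {v \<in> A. degree P v = 4} = 1 \<and> card {v \<in> B. degree P v = 4} = 1))"
proof -
  interpret F: fullerene_map F using assms(1) by unfold_locales
  have cs: "resonant_pattern F H" "card H = clar_number F"
      "perfect_matching_on F (vertices F - (\<Union>f \<in> H. face_verts F f)) M"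
    using assms(5) by (simp_all add: clar_structure_def clar_set_def)
  interpret C: clar_map F H M
  proof unfold_locales
    show "H \<subseteq> faces F" "pairwise (\<lambda>f g. disjnt (face_verts F f) (face_verts F g)) H"
      using cs(1) by (simp_all add: resonant_pattern_def)
    show "card f = 6" if "f \<in> H" for f
      using cs(1) that F.alternating_hexagon unfolding resonant_pattern_def by blast
  qed (rule cs(3))
  have "\<lfloor>real n / 6\<rfloor> = int (n div 6)" using floor_divide_of_nat_eq[of n 6] by simp
  then have "int (card H) = int (n div 6) - 2" using assms(4) cs(2) by simp
  \<comment> \<open>With remainder 4 and quotient \<open>card H + 2\<close>, the constant is 6 * 2 +
    4 = 16.\<close>
  then have n: "n = 6 * card H + 16" using assms(3) by presburger
  interpret C: clar_map_16 F H M
  proof unfold_locales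
    show "card C.MD = 16" using n C.card_V C.card_HD assms(2) by simp
  qed
  have quads: "card {f \<in> faces (parent F H M). is_gon 4 (parent F H M) f} = 8"
    using C.card_quads_P C.card_MD by simp
  have verts: "real (card (vertices (parent F H M))) = (real n + 14) / 3"
    unfolding C.card_verts_P_16 n by simp
  show ?thesis
    unfolding assms(6)
    using C.plane_P verts quads C.faces_P_gon C.degrees_P C.quads_at_degree_4 C.P_even_cut
      C.bipartition_degree_4 by blast
qed

end
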